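(* Assume the setting and Assumptions 1–2 of the context, and run the FedAvg algorithm with constant stepsize $\eta=\sqrt{bK/T}$ and, for a fixed $\nu\in[0,1]$, $$I=\mathcal{O}\big((T/K^3)^{\nu/4}\big),\qquad b=\mathcal{O}\big((T/K^3)^{1/3-\nu/3}\big),$$ with $T\ge81L^2I^2bK$. Then: (i) $$\mathbb{E}\|\nabla f(\bar x_a)\|^2=\mathcal{O}\Big(\frac{f(\bar x_1)-f^\ast}{K^{\nu/2}T^{2/3-\nu/6}}\Big)+\mathcal{O}\Big(\frac{\sigma^2}{K^{\nu/2}T^{2/3-\nu/6}}\Big)+\mathcal{O}\Big(\frac{\zeta^2}{K^{\nu/2}T^{2/3-\nu/6}}\Big);$$ (ii) for every $\nu\in[0,1]$, the sample complexity of FedAvg is $\mathcal{O}(\epsilon^{-2})$, i.e. $\mathcal O(K^{-1}\epsilon^{-2})$ gradient computations per worker, and its communication complexity is $\mathcal{O}(\epsilon^{-3/2})$.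
   Context: Setting: $K\ge1$ worker nodes. For each $k$, $f^{(k)}(x)=\mathbb{E}_{\xi\sim\mathcal{D}^{(k)}}[f^{(k)}(x;\xi)]$ on $\mathbb{R}^d$. The objective is $f=\frac1K\sum_kf^{(k)}$, with $f^\ast=\inf f>-\infty$. Assumption 1: $\mathbb{E}\|\nabla f^{(k)}(x;\xi)-\nabla f^{(k)}(y;\xi)\|^2\le L^2\|x-y\|^2$. Assumption 2: $\mathbb{E}[\nabla f^{(k)}(x;\xi)]=\nabla f^{(k)}(x)$, $\mathbb{E}\|\nabla f^{(k)}(x;\xi)-\nabla f^{(k)}(x)\|^2\le\sigma^2$, and $\|\nabla f^{(k)}(x)-\nabla f^{(\ell)}(x)\|^2\le\zeta^2$. Samples are i.i.d., independent across nodes and of the past. FedAvg algorithm (local SGD). Parameters: stepsize $\eta$, number of local updates $I$, minibatch size $b$. Initialization: all $x_1^{(k)}=\bar x_1$. For $t=1,\dots,T$ and each $k$: $d_t^{(k)}=\frac1b\sum_{\xi\in\mathcal{B}_t^{(k)}}\nabla f^{(k)}(x_t^{(k)};\xi)$ with a fresh minibatch, $|\mathcal B_t^{(k)}|=b$, and $x_{t+1}^{(k)}=x_t^{(k)}-\eta d_t^{(k)}$. If $t\bmod I=0$, then $x_{t+1}^{(k)}$ is replaced by $\bar x_{t+1}=\frac1K\sum_jx_{t+1}^{(j)}$ for all $k$ (one communication round). Here $\bar x_t=\frac1K\sum_kx_t^{(k)}$. Output: $\bar x_a$, uniform on $\{\bar x_t\}_{t=1}^T$. Sample complexity is the total number of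 stochastic gradient evaluations to reach $\mathbb{E}\|\nabla f(\bar x_a)\|^2\le\epsilon$. Communication complexity is the number of rounds $T/I$.
   Formalization: The minibatch rule is read as b = Θ((T/K³)^{1/3−ν/3}): a lower bound on b is added, since with only b = O(·) the rate (i) fails (e.g. ν=0, b=K=1, quadratic f gives order T^{-1/2}). Hidden constants are for a fixed dimension d, and in (ii) ε is below a threshold depending on K. *)

theory Defs
  imports "HOL-Probability.Probability"
begin

text \<open>Parameter space: an abstract Euclidean space 'd (= R^d). Data points \<xi> live in a
measurable space S; node k samples from the distribution D k.
F k = f^(k), G k = gradient of f^(k), g k x \<xi> = stochastic gradient of f^(k) at x.\<close>

definition fed_obj :: "(nat \<Rightarrow> 'd \<Rightarrow> real) \<Rightarrow> nat \<Rightarrow> 'd \<Rightarrow> real" where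
  "fed_obj F K x = (1 / real K) * (\<Sum>k<K. F k x)"

definition fed_grad :: "(nat \<Rightarrow> 'd \<Rightarrow> 'd::real_vector) \<Rightarrow> nat \<Rightarrow> 'd \<Rightarrow> 'd" where
  "fed_grad G K x = (1 / real K) *\<^sub>R (\<Sum>k<K. G k x)"

definition fed_fstar :: "(nat \<Rightarrow> 'd \<Rightarrow> real) \<Rightarrow> nat \<Rightarrow> real" where
  "fed_fstar F K = Inf (range (fed_obj F K))"

definition fed_assumptions ::
  "'a measure \<Rightarrow> (nat \<Rightarrow> 'a measure) \<Rightarrow> nat \<Rightarrow> (nat \<Rightarrow> 'd::euclidean_space \<Rightarrow> real)
   \<Rightarrow> (nat \<Rightarrow> 'd \<Rightarrow> 'd) \<Rightarrow> (nat \<Rightarrow> 'd \<Rightarrow> 'a \<Rightarrow> 'd) \<Rightarrow> real \<Rightarrow> real \<Rightarrow> real \<Rightarrow> bool" where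
  "fed_assumptions S D K F G g L \<sigma> \<zeta> \<longleftrightarrow>
     (\<forall>k<K. prob_space (D k) \<and> sets (D k) = sets S) \<and>
     (\<forall>k<K. (\<lambda>(x, \<xi>). g k x \<xi>) \<in> borel \<Otimes>\<^sub>M S \<rightarrow>\<^sub>M borel) \<and>
     (\<forall>k<K. \<forall>x. (F k has_derivative (\<lambda>h. G k x \<bullet> h)) (at x)) \<and>
     bdd_below (range (fed_obj F K)) \<and>
     \<comment> \<open>Assumption 1 (mean-squared smoothness)\<close>
     (\<forall>k<K. \<forall>x y. (\<integral>\<^sup>+ \<xi>. ennreal ((norm (g k x \<xi> - g k y \<xi>))\<^sup>2) \<partial>D k)
                      \<le> ennreal (L\<^sup>2 * (norm (x - y))\<^sup>2)) \<and>
     \<comment> \<open>Assumption 2: unbiasedness, bounded variance, bounded heterogeneity\<close>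
     (\<forall>k<K. \<forall>x. integrable (D k) (g k x) \<and> (\<integral>\<xi>. g k x \<xi> \<partial>D k) = G k x) \<and>
     (\<forall>k<K. \<forall>x. (\<integral>\<^sup>+ \<xi>. ennreal ((norm (g k x \<xi> - G k x))\<^sup>2) \<partial>D k) \<le> ennreal (\<sigma>\<^sup>2)) \<and>
     (\<forall>k<K. \<forall>l<K. \<forall>x. (norm (G k x - G l x))\<^sup>2 \<le> \<zeta>\<^sup>2)"

text \<open>Sampling: \<xi> t k j is the j-th sample of the minibatch of node k at iteration t.
All samples are independent; sample (t,k,j) has distribution D k.\<close>
definition fed_samples ::
  "'m measure \<Rightarrow> 'a measure \<Rightarrow> (nat \<Rightarrow> 'a measure) \<Rightarrow> nat \<Rightarrow> nat
   \<Rightarrow> (nat \<Rightarrow> nat \<Rightarrow> nat \<Rightarrow> 'm \<Rightarrow> 'a) \<Rightarrow> bool" where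
  "fed_samples M S D K b \<xi> \<longleftrightarrow>
     prob_space M \<and>
     prob_space.indep_vars M (\<lambda>_. S) (\<lambda>(t, k, j). \<xi> t k j) {(t, k, j). k < K \<and> j < b} \<and>
     (\<forall>t k j. k < K \<and> j < b \<longrightarrow> distr M S (\<xi> t k j) = D k)"

text \<open>FedAvg iterates for one realisation s of the samples:
fedavg_x ... t k = x_t^(k) (t \<ge> 1; the value at t = 0 is irrelevant).\<close>
primrec fedavg_x ::
  "(nat \<Rightarrow> 'd \<Rightarrow> 'a \<Rightarrow> 'd::real_vector) \<Rightarrow> real \<Rightarrow> nat \<Rightarrow> nat \<Rightarrow> nat \<Rightarrow> 'd
   \<Rightarrow> (nat \<Rightarrow> nat \<Rightarrow> nat \<Rightarrow> 'a) \<Rightarrow> nat \<Rightarrow> nat \<Rightarrow> 'd" where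
  "fedavg_x g \<eta> I b K x1 s 0 = (\<lambda>k. x1)"
| "fedavg_x g \<eta> I b K x1 s (Suc t) =
     (if t = 0 then (\<lambda>k. x1) else
      (let x = fedavg_x g \<eta> I b K x1 s t;
           y = (\<lambda>k. x k - \<eta> *\<^sub>R ((1 / real b) *\<^sub>R (\<Sum>j<b. g k (x k) (s t k j))))
       in if t mod I = 0 then (\<lambda>k. (1 / real K) *\<^sub>R (\<Sum>j<K. y j)) else y))"

definition fedavg_bar ::
  "(nat \<Rightarrow> 'd \<Rightarrow> 'a \<Rightarrow> 'd::real_vector) \<Rightarrow> real \<Rightarrow> nat \<Rightarrow> nat \<Rightarrow> nat \<Rightarrow> 'd
   \<Rightarrow> (nat \<Rightarrow> nat \<Rightarrow> nat \<Rightarrow> 'a) \<Rightarrow> nat \<Rightarrow> 'd" where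
  "fedavg_bar g \<eta> I b K x1 s t = (1 / real K) *\<^sub>R (\<Sum>k<K. fedavg_x g \<eta> I b K x1 s t k)"

text \<open>E ||grad f(xbar_a)||^2 with a uniform on {1..T}, independent of the samples:
the average over t of E ||grad f(xbar_t)||^2 (nonnegative integral, so no integrability
side conditions are hidden).\<close>
definition fedavg_error ::
  "'m measure \<Rightarrow> (nat \<Rightarrow> 'd \<Rightarrow> 'a \<Rightarrow> 'd::real_normed_vector) \<Rightarrow> (nat \<Rightarrow> 'd \<Rightarrow> 'd) \<Rightarrow> real
   \<Rightarrow> nat \<Rightarrow> nat \<Rightarrow> nat \<Rightarrow> 'd \<Rightarrow> (nat \<Rightarrow> nat \<Rightarrow> nat \<Rightarrow> 'm \<Rightarrow> 'a) \<Rightarrow> nat \<Rightarrow> ennreal" where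
  "fedavg_error M g G \<eta> I b K x1 \<xi> T =
     (\<Sum>t\<in>{1..T}. \<integral>\<^sup>+ \<omega>. ennreal ((norm (fed_grad G K
          (fedavg_bar g \<eta> I b K x1 (\<lambda>t k j. \<xi> t k j \<omega>) t)))\<^sup>2) \<partial>M) / ennreal (real T)"

definition fedavg_stepsize :: "nat \<Rightarrow> nat \<Rightarrow> nat \<Rightarrow> real" where
  "fedavg_stepsize K T b = sqrt (real b * real K / real T)"

text \<open>Parameter rule, with the constant c hidden in the O-notation:
I = O((T/K^3)^(\<nu>/4)), b = \<Theta>((T/K^3)^(1/3-\<nu>/3)), T \<ge> 81 L^2 I^2 b K.\<close>
definition fedavg_params :: "real \<Rightarrow> real \<Rightarrow> real \<Rightarrow> nat \<Rightarrow> nat \<Rightarrow> nat \<Rightarrow> nat \<Rightarrow> bool" where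
  "fedavg_params \<nu> c L K T I b \<longleftrightarrow>
     1 \<le> K \<and> 1 \<le> T \<and> 1 \<le> I \<and> 1 \<le> b \<and>
     real I \<le> c * (real T / real K ^ 3) powr (\<nu> / 4) \<and>
     (real T / real K ^ 3) powr ((1 - \<nu>) / 3) \<le> c * real b \<and>
     real b \<le> c * (real T / real K ^ 3) powr ((1 - \<nu>) / 3) \<and>
     81 * L\<^sup>2 * (real I)\<^sup>2 * real b * real K \<le> real T"

end

theory Submission
  imports Defs
begin

text \<open>
  The averaged iterate performs SGD on \<open>f\<close> with the biased gradient \<open>(1/K) \<Sum>\<^sub>k \<nabla>f\<^sub>k(x\<^sub>t\<^sup>k)\<close>.
  Its squared bias is at most \<open>L\<^sup>2\<close> times the mean squared drift of the local iterates, and its noise has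
  variance \<open>\<sigma>\<^sup>2/(bK)\<close> because fresh samples are uncorrelated. Since \<open>\<eta> L I \<le> 1/9\<close>, the drift stays
  below \<open>6 \<eta>\<^sup>2 I\<^sup>2 (\<sigma>\<^sup>2 + \<zeta>\<^sup>2)\<close>. Summing the descent inequality therefore bounds the error by
  \<open>2 (f(x\<^sub>1) - f*) / (\<eta> T) + 6 L\<^sup>2 \<eta>\<^sup>2 I\<^sup>2 (\<sigma>\<^sup>2 + \<zeta>\<^sup>2) + L \<eta> \<sigma>\<^sup>2 / (bK)\<close>.
  With \<open>\<eta> = sqrt (bK/T)\<close> every term is \<open>O(1/y)\<close> for \<open>y = K\<^bsup>\<nu>/2\<^esup> T\<^bsup>2/3-\<nu>/6\<^esup>\<close>. For the complexities,
  \<open>T b K\<close> is of order \<open>y\<^sup>2\<close> and \<open>T/I\<close> of order \<open>y\<^bsup>3/2\<^esup>\<close>, and \<open>T\<close> is taken with \<open>y\<close> of order \<open>1/\<epsilon>\<close>.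
\<close>

section \<open>Norm inequalities and descent for smooth functions\<close>

text \<open>The triangle inequality, then Cauchy-Schwarz against the vector of ones. For empty
  \<open>A\<close> both sides vanish because \<open>1 / 0 = 0\<close>.\<close>

lemma norm_mean_sq_le:
  fixes v :: "'i \<Rightarrow> 'd::real_normed_vector"
  assumes "finite A"
  shows "(norm ((1 / real (card A)) *\<^sub>R (\<Sum>i\<in>A. v i)))\<^sup>2 \<le> (1 / real (card A)) * (\<Sum>i\<in>A. (norm (v i))\<^sup>2)"
proof (cases "A = {}")
  case False
  let ?n = "real (card A)"
  have n: "?n > 0" using assms False by (simp add: card_gt_0_iff)
  have "(norm (\<Sum>i\<in>A. v i))\<^sup>2 \<le> (\<Sum>i\<in>A. norm (v i))\<^sup>2"
    by (intro power_mono norm_sum) auto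
  also have "\<dots> \<le> (\<Sum>i\<in>A. (norm (v i))\<^sup>2) * ?n"
    by (rule sum_squared_le_sum_of_squares)
  finally show ?thesis
    using n by (simp add: power_mult_distrib field_simps power2_eq_square)
qed simp

lemma norm_add3_sq_le:
  fixes a b c :: "'d::real_normed_vector"
  shows "(norm (a + b + c))\<^sup>2 \<le> 3 * ((norm a)\<^sup>2 + (norm b)\<^sup>2 + (norm c)\<^sup>2)"
proof -
  have "norm (a + b + c) \<le> norm a + norm b + norm c"
    by (metis add_right_mono norm_triangle_ineq order_trans)
  then have "(norm (a + b + c))\<^sup>2 \<le> (norm a + norm b + norm c)\<^sup>2"
    by (intro power_mono) auto
  \<comment> \<open>The difference of the two sides is the sum of the squares of the three pairwise
    differences.\<close>
  also have "\<dots> \<le> 3 * ((norm a)\<^sup>2 + (norm b)\<^sup>2 + (norm c)\<^sup>2)"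
    using sum_squares_ge_zero[of "norm a - norm b" "norm a - norm c"] zero_le_square[of "norm b - norm c"]
    by (simp add: power2_eq_square algebra_simps)
  finally show ?thesis .
qed

text \<open>Expanding the nonnegative quantity \<open>(norm (a + r *\<^sub>R b))^2 / r\<close>
  bounds the cross term. The weight \<open>r\<close> stays free so that the drift recursion can set
  it to the number of local steps already made.\<close>

lemma norm_diff_sq_le_Young:
  fixes a b :: "'d::real_inner"
  assumes "r > 0"
  shows "(norm (a - b))\<^sup>2 \<le> (1 + 1 / r) * (norm a)\<^sup>2 + (1 + r) * (norm b)\<^sup>2"
proof -
  have "0 \<le> (norm (a + r *\<^sub>R b))\<^sup>2 / r" using assms by simp
  also have "\<dots> = (1 / r) * (norm a)\<^sup>2 + 2 * (a \<bullet> b) + r * (norm b)\<^sup>2"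
    using assms unfolding power2_norm_eq_inner
    by (simp add: inner_add_left inner_add_right inner_commute field_simps)
  finally show ?thesis
    unfolding power2_norm_eq_inner
    by (simp add: inner_diff_left inner_diff_right inner_commute algebra_simps)
qed

text \<open>Deviations from the mean sum to zero, so the cross term of the expansion vanishes and
  another centre only adds \<open>real K * (norm (m - c))^2\<close>. This later permits a more
  convenient centre than the average direction.\<close>

lemma sum_norm_sq_mean_le:
  fixes v :: "nat \<Rightarrow> 'd::real_inner"
  assumes "K \<ge> 1" and m: "m = (1 / real K) *\<^sub>R (\<Sum>k<K. v k)"
  shows "(\<Sum>k<K. (norm (v k - m))\<^sup>2) \<le> (\<Sum>k<K. (norm (v k - c))\<^sup>2)"
proof -
  have "(norm (v k - c))\<^sup>2 = (norm (v k - m))\<^sup>2 + 2 * ((v k - m) \<bullet> (m - c)) + (norm (m - c))\<^sup>2" for k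
    unfolding power2_norm_eq_inner
    by (simp add: inner_diff_left inner_diff_right inner_commute)
  then have "(\<Sum>k<K. (norm (v k - c))\<^sup>2) = (\<Sum>k<K. (norm (v k - m))\<^sup>2)
      + 2 * ((\<Sum>k<K. v k - m) \<bullet> (m - c)) + real K * (norm (m - c))\<^sup>2"
    by (simp add: sum.distrib sum_distrib_left inner_sum_left)
  moreover have "(\<Sum>k<K. v k - m) = 0"
    using assms by (simp add: sum_subtractf sum_constant_scaleR)
  ultimately show ?thesis by simp
qed

text \<open>Along the segment from \<open>x\<close> to \<open>x + h\<close>, the value of
  \<open>f\<close> minus its quadratic model is nonincreasing: the derivative is
  \<open>(f' (x + t h) - f' x) \<bullet> h - L t |h|^2\<close>, which Cauchy-Schwarz and the
  Lipschitz bound make nonpositive.\<close>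

lemma smooth_descent:
  fixes f :: "'d::euclidean_space \<Rightarrow> real" and f' :: "'d \<Rightarrow> 'd"
  assumes der: "\<And>x. (f has_derivative (\<lambda>h. f' x \<bullet> h)) (at x)"
    and lip: "\<And>x y. norm (f' x - f' y) \<le> L * norm (x - y)"
  shows "f (x + h) \<le> f x + f' x \<bullet> h + L / 2 * (norm h)\<^sup>2"
proof -
  let ?p = "\<lambda>t. f (x + t *\<^sub>R h) - t * (f' x \<bullet> h) - L / 2 * t\<^sup>2 * (norm h)\<^sup>2"
  have "?p 1 \<le> ?p 0"
  proof (rule DERIV_nonpos_imp_nonincreasing[where f = ?p])
    fix t :: real assume t: "0 \<le> t" "t \<le> 1"
    have "((\<lambda>t. f (x + t *\<^sub>R h)) has_derivative (\<lambda>s. f' (x + t *\<^sub>R h) \<bullet> (s *\<^sub>R h))) (at t)"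
      by (rule has_derivative_compose[OF _ der])
         (auto intro!: derivative_eq_intros)
    then have "((\<lambda>t. f (x + t *\<^sub>R h)) has_real_derivative (f' (x + t *\<^sub>R h) \<bullet> h)) (at t)"
      unfolding has_field_derivative_def by (simp add: mult_commute_abs)
    then have "(?p has_real_derivative
        (f' (x + t *\<^sub>R h) \<bullet> h - f' x \<bullet> h - L / 2 * (2 * t) * (norm h)\<^sup>2)) (at t)"
      by (auto intro!: derivative_eq_intros)
    moreover have "f' (x + t *\<^sub>R h) \<bullet> h - f' x \<bullet> h - L / 2 * (2 * t) * (norm h)\<^sup>2 \<le> 0"
    proof -
      have "(f' (x + t *\<^sub>R h) - f' x) \<bullet> h \<le> norm (f' (x + t *\<^sub>R h) - f' x) * norm h"
        by (rule norm_cauchy_schwarz)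
      also have "\<dots> \<le> (L * norm (t *\<^sub>R h)) * norm h"
        using lip[of "x + t *\<^sub>R h" x] by (intro mult_right_mono) auto
      finally show ?thesis using t by (simp add: inner_diff_left power2_eq_square)
    qed
    ultimately show "\<exists>y. (?p has_real_derivative y) (at t) \<and> y \<le> 0" by blast
  qed simp
  then show ?thesis by simp
qed

section \<open>Square-integrable random vectors\<close>

text \<open>Measurability and a finite second moment are bundled because this class is closed under
  all operations of the algorithm; the integrability conditions of later expectations then follow by
  introduction rules.\<close>

definition sq_integrable :: "'m measure \<Rightarrow> ('m \<Rightarrow> 'd::euclidean_space) \<Rightarrow> bool" where
  "sq_integrable M X \<longleftrightarrow> X \<in> borel_measurable M \<and> integrable M (\<lambda>\<omega>. (norm (X \<omega>))\<^sup>2)"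

lemma sq_integrable_measurable: "sq_integrable M X \<Longrightarrow> X \<in> borel_measurable M"
  and sq_integrable_norm_sq: "sq_integrable M X \<Longrightarrow> integrable M (\<lambda>\<omega>. (norm (X \<omega>))\<^sup>2)"
  by (simp_all add: sq_integrable_def)

lemma sq_integrable_add:
  assumes "sq_integrable M X" "sq_integrable M Y"
  shows "sq_integrable M (\<lambda>\<omega>. X \<omega> + Y \<omega>)"
  unfolding sq_integrable_def
proof
  note [measurable] = assms[THEN sq_integrable_measurable]
  show "(\<lambda>\<omega>. X \<omega> + Y \<omega>) \<in> borel_measurable M" by measurable
  have "integrable M (\<lambda>\<omega>. 2 * (norm (X \<omega>))\<^sup>2 + 2 * (norm (Y \<omega>))\<^sup>2)"
    using assms[THEN sq_integrable_norm_sq] by auto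
  then show "integrable M (\<lambda>\<omega>. (norm (X \<omega> + Y \<omega>))\<^sup>2)"
  proof (rule Bochner_Integration.integrable_bound)
    show "AE \<omega> in M. norm ((norm (X \<omega> + Y \<omega>))\<^sup>2) \<le> norm (2 * (norm (X \<omega>))\<^sup>2 + 2 * (norm (Y \<omega>))\<^sup>2)"
      using norm_diff_sq_le_Young[of 1 "X _" "- Y _"] by auto
  qed measurable
qed

lemma sq_integrable_scaleR:
  "sq_integrable M X \<Longrightarrow> sq_integrable M (\<lambda>\<omega>. c *\<^sub>R X \<omega>)"
  unfolding sq_integrable_def by (auto simp: power_mult_distrib)

lemma sq_integrable_minus:
  "sq_integrable M X \<Longrightarrow> sq_integrable M (\<lambda>\<omega>. - X \<omega>)"
  unfolding sq_integrable_def by auto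

lemma sq_integrable_diff:
  "sq_integrable M X \<Longrightarrow> sq_integrable M Y \<Longrightarrow> sq_integrable M (\<lambda>\<omega>. X \<omega> - Y \<omega>)"
  using sq_integrable_add[OF _ sq_integrable_minus] by fastforce

lemma (in finite_measure) sq_integrable_const: "sq_integrable M (\<lambda>\<omega>. c)"
  unfolding sq_integrable_def by simp

lemma (in finite_measure) sq_integrable_sum:
  "(\<And>i. i \<in> A \<Longrightarrow> sq_integrable M (X i)) \<Longrightarrow> sq_integrable M (\<lambda>\<omega>. \<Sum>i\<in>A. X i \<omega>)"
  by (induction A rule: infinite_finite_induct)
     (auto intro!: sq_integrable_add sq_integrable_const)

text \<open>The difference to the constant \<open>h 0\<close> is dominated by \<open>L\<close> times
  the norm of \<open>X\<close>, and constants are square integrable on a finite measure.\<close>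

lemma (in finite_measure) sq_integrable_lipschitz:
  fixes h :: "'d::euclidean_space \<Rightarrow> 'e::euclidean_space"
  assumes X: "sq_integrable M X" and lip: "\<And>x y. norm (h x - h y) \<le> L * norm (x - y)"
    and h: "h \<in> borel_measurable borel"
  shows "sq_integrable M (\<lambda>\<omega>. h (X \<omega>))"
proof -
  note [measurable] = X[THEN sq_integrable_measurable] h
  have "sq_integrable M (\<lambda>\<omega>. h (X \<omega>) - h 0)"
    unfolding sq_integrable_def
  proof
    have "integrable M (\<lambda>\<omega>. L\<^sup>2 * (norm (X \<omega>))\<^sup>2)"
      using X[THEN sq_integrable_norm_sq] by auto
    then show "integrable M (\<lambda>\<omega>. (norm (h (X \<omega>) - h 0))\<^sup>2)"
    proof (rule Bochner_Integration.integrable_bound)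
      have "(norm (h x - h 0))\<^sup>2 \<le> L\<^sup>2 * (norm x)\<^sup>2" for x
        using power_mono[OF lip[of x 0], of 2] by (simp add: power_mult_distrib)
      then show "AE \<omega> in M. norm ((norm (h (X \<omega>) - h 0))\<^sup>2) \<le> norm (L\<^sup>2 * (norm (X \<omega>))\<^sup>2)"
        by simp
    qed measurable
  qed measurable
  from sq_integrable_add[OF this sq_integrable_const[of "h 0"]] show ?thesis by simp
qed

lemma sq_integrable_inner:
  assumes "sq_integrable M X" "sq_integrable M Y"
  shows "integrable M (\<lambda>\<omega>. X \<omega> \<bullet> Y \<omega>)"
proof -
  note [measurable] = assms[THEN sq_integrable_measurable]
  have "integrable M (\<lambda>\<omega>. (norm (X \<omega>))\<^sup>2 + (norm (Y \<omega>))\<^sup>2)"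
    using assms[THEN sq_integrable_norm_sq] by auto
  then show ?thesis
  proof (rule Bochner_Integration.integrable_bound)
    have "\<bar>x \<bullet> y\<bar> \<le> (norm x)\<^sup>2 + (norm y)\<^sup>2" for x y :: 'b
    proof -
      have "\<bar>x \<bullet> y\<bar> \<le> norm x * norm y" by (rule Cauchy_Schwarz_ineq2)
      also have "\<dots> \<le> (norm x)\<^sup>2 + (norm y)\<^sup>2"
        using sum_squares_bound[of "norm x" "norm y"] mult_nonneg_nonneg[OF norm_ge_zero[of x] norm_ge_zero[of y]]
        by linarith
      finally show ?thesis .
    qed
    then show "AE \<omega> in M. norm (X \<omega> \<bullet> Y \<omega>) \<le> norm ((norm (X \<omega>))\<^sup>2 + (norm (Y \<omega>))\<^sup>2)"
      by simp
  qed measurable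
qed

text \<open>Jensen's inequality for the squared norm, read off from the nonnegativity of the
  variance of \<open>h\<close>.\<close>

lemma (in prob_space) norm_expectation_sq_le:
  fixes h :: "'a \<Rightarrow> 'd::euclidean_space"
  assumes "sq_integrable M h" "integrable M h"
  shows "(norm (expectation h))\<^sup>2 \<le> expectation (\<lambda>\<omega>. (norm (h \<omega>))\<^sup>2)"
proof -
  let ?m = "expectation h"
  have "0 \<le> expectation (\<lambda>\<omega>. (norm (h \<omega> - ?m))\<^sup>2)" by simp
  also have "\<dots> = expectation (\<lambda>\<omega>. (norm (h \<omega>))\<^sup>2 - 2 * (h \<omega> \<bullet> ?m) + (norm ?m)\<^sup>2)"
    unfolding power2_norm_eq_inner
    by (rule Bochner_Integration.integral_cong) (auto simp: inner_diff_left inner_diff_right inner_commute)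
  also have "\<dots> = expectation (\<lambda>\<omega>. (norm (h \<omega>))\<^sup>2) - 2 * (?m \<bullet> ?m) + (norm ?m)\<^sup>2"
    using assms sq_integrable_norm_sq[OF assms(1)] by (simp add: prob_space)
  finally show ?thesis by (simp add: power2_norm_eq_inner)
qed

text \<open>Pythagoras in L^2: the square expands into a double sum of inner products, and all
  off-diagonal terms have mean zero.\<close>

lemma (in prob_space) norm_sq_sum_orthogonal:
  fixes N :: "'i \<Rightarrow> 'a \<Rightarrow> 'd::euclidean_space"
  assumes A: "finite A" and sq: "\<And>p. p \<in> A \<Longrightarrow> sq_integrable M (N p)"
    and orth: "\<And>p q. p \<in> A \<Longrightarrow> q \<in> A \<Longrightarrow> p \<noteq> q \<Longrightarrow> expectation (\<lambda>\<omega>. N p \<omega> \<bullet> N q \<omega>) = 0"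
  shows "expectation (\<lambda>\<omega>. (norm (\<Sum>p\<in>A. N p \<omega>))\<^sup>2) = (\<Sum>p\<in>A. expectation (\<lambda>\<omega>. (norm (N p \<omega>))\<^sup>2))"
proof -
  have "expectation (\<lambda>\<omega>. (norm (\<Sum>p\<in>A. N p \<omega>))\<^sup>2) = expectation (\<lambda>\<omega>. \<Sum>p\<in>A. \<Sum>q\<in>A. N q \<omega> \<bullet> N p \<omega>)"
    unfolding power2_norm_eq_inner by (simp add: inner_sum_left inner_sum_right)
  also have "\<dots> = (\<Sum>p\<in>A. \<Sum>q\<in>A. expectation (\<lambda>\<omega>. N q \<omega> \<bullet> N p \<omega>))"
    using sq by (subst Bochner_Integration.integral_sum)
      (auto intro!: sq_integrable_inner Bochner_Integration.integrable_sum sum.cong Bochner_Integration.integral_sum)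
  also have "\<dots> = (\<Sum>p\<in>A. \<Sum>q\<in>A. if p = q then expectation (\<lambda>\<omega>. N p \<omega> \<bullet> N p \<omega>) else 0)"
    using orth by (auto intro!: sum.cong)
  also have "\<dots> = (\<Sum>p\<in>A. expectation (\<lambda>\<omega>. (norm (N p \<omega>))\<^sup>2))"
    using A by (simp add: power2_norm_eq_inner)
  finally show ?thesis .
qed

text \<open>The assumptions bound nonnegative integrals; this is the passage to Bochner integrals,
  where linearity is available.\<close>

lemma integrable_of_nn_integral_le:
  fixes f :: "'m \<Rightarrow> real"
  assumes "f \<in> borel_measurable M" "\<And>\<omega>. 0 \<le> f \<omega>" "(\<integral>\<^sup>+ \<omega>. ennreal (f \<omega>) \<partial>M) \<le> ennreal c" "0 \<le> c"
  shows "integrable M f" and "integral\<^sup>L M f \<le> c"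
proof -
  show int: "integrable M f"
    by (rule integrableI_nonneg) (use assms in \<open>auto simp: le_less_trans\<close>)
  have "ennreal (integral\<^sup>L M f) \<le> ennreal c"
    using nn_integral_eq_integral[OF int] assms by auto
  then show "integral\<^sup>L M f \<le> c" using assms by simp
qed

section \<open>Samples and independence\<close>

text \<open>The horizon \<open>T\<close>, the exponent \<nu> and the constant \<open>c\<close> are
  absent here: the analysis uses them only through \<open>step_small\<close>, which is
  \<open>T \<ge> 81 L^2 I^2 b K\<close> rewritten with \<open>\<eta>^2 = b K / T\<close>.\<close>

locale fedavg_run = prob_space M
  for M :: "'m measure" +
  fixes S :: "'a measure" and D :: "nat \<Rightarrow> 'a measure" and K :: nat
    and F :: "nat \<Rightarrow> 'd::euclidean_space \<Rightarrow> real" and G :: "nat \<Rightarrow> 'd \<Rightarrow> 'd"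
    and g :: "nat \<Rightarrow> 'd \<Rightarrow> 'a \<Rightarrow> 'd" and L \<sigma> \<zeta> \<eta> :: real and I b :: nat and x1 :: 'd
    and \<xi> :: "nat \<Rightarrow> nat \<Rightarrow> nat \<Rightarrow> 'm \<Rightarrow> 'a"
  assumes assumptions: "fed_assumptions S D K F G g L \<sigma> \<zeta>"
    and samples: "fed_samples M S D K b \<xi>"
    and K_pos: "1 \<le> K" and I_pos: "1 \<le> I" and b_pos: "1 \<le> b"
    and L_pos: "0 < L" and eta_pos: "0 < \<eta>"
    and step_small: "81 * L\<^sup>2 * (real I)\<^sup>2 * \<eta>\<^sup>2 \<le> 1"
begin

section \<open>Consequences of the assumptions for the expected gradients\<close>

lemma prob_D: "k < K \<Longrightarrow> prob_space (D k)"
  and sets_D: "k < K \<Longrightarrow> sets (D k) = sets S"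
  and g_measurable: "k < K \<Longrightarrow> (\<lambda>(x, z). g k x z) \<in> borel \<Otimes>\<^sub>M S \<rightarrow>\<^sub>M borel"
  and F_deriv: "k < K \<Longrightarrow> (F k has_derivative (\<lambda>h. G k x \<bullet> h)) (at x)"
  and bdd_obj: "bdd_below (range (fed_obj F K))"
  and g_smooth: "k < K \<Longrightarrow> (\<integral>\<^sup>+ z. ennreal ((norm (g k x z - g k y z))\<^sup>2) \<partial>D k)
                      \<le> ennreal (L\<^sup>2 * (norm (x - y))\<^sup>2)"
  and g_integrable: "k < K \<Longrightarrow> integrable (D k) (g k x)"
  and g_unbiased: "k < K \<Longrightarrow> (\<integral>z. g k x z \<partial>D k) = G k x"
  and g_variance: "k < K \<Longrightarrow> (\<integral>\<^sup>+ z. ennreal ((norm (g k x z - G k x))\<^sup>2) \<partial>D k) \<le> ennreal (\<sigma>\<^sup>2)"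
  and G_hetero: "k < K \<Longrightarrow> l < K \<Longrightarrow> (norm (G k x - G l x))\<^sup>2 \<le> \<zeta>\<^sup>2"
  using assumptions unfolding fed_assumptions_def by simp_all

lemma samples_indep: "indep_vars (\<lambda>_. S) (\<lambda>(t, k, j). \<xi> t k j) {(t, k, j). k < K \<and> j < b}"
  and distr_sample: "k < K \<Longrightarrow> j < b \<Longrightarrow> distr M S (\<xi> t k j) = D k"
  using samples unfolding fed_samples_def by blast+

lemma sample_measurable:
  assumes "k < K" "j < b" shows "\<xi> t k j \<in> measurable M S"
  using samples_indep assms unfolding indep_vars_def by auto

text \<open>By unbiasedness, the difference of expected gradients is the expectation of the
  difference of stochastic gradients, so Jensen's inequality transfers mean-squared smoothness to
  \<open>G k\<close>.\<close>

lemma G_lipschitz: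
  assumes k: "k < K"
  shows "norm (G k x - G k y) \<le> L * norm (x - y)"
proof -
  interpret Dk: prob_space "D k" using prob_D[OF k] .
  let ?h = "\<lambda>z. g k x z - g k y z"
  have int: "integrable (D k) ?h" using g_integrable[OF k] by simp
  then have sq: "integrable (D k) (\<lambda>z. (norm (?h z))\<^sup>2)"
    and le: "(\<integral>z. (norm (?h z))\<^sup>2 \<partial>D k) \<le> L\<^sup>2 * (norm (x - y))\<^sup>2"
    using integrable_of_nn_integral_le[OF _ _ g_smooth[OF k, of x y]] by auto
  have "(norm (G k x - G k y))\<^sup>2 = (norm (Dk.expectation ?h))\<^sup>2"
    using g_integrable[OF k] g_unbiased[OF k] by simp
  also have "\<dots> \<le> (\<integral>z. (norm (?h z))\<^sup>2 \<partial>D k)"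
    using int sq by (intro Dk.norm_expectation_sq_le) (auto simp: sq_integrable_def)
  finally have "(norm (G k x - G k y))\<^sup>2 \<le> (L * norm (x - y))\<^sup>2"
    using le by (simp add: power_mult_distrib)
  then show ?thesis
    by (rule power2_le_imp_le) (use L_pos in simp)
qed

lemma G_measurable:
  assumes "k < K" shows "G k \<in> borel_measurable borel"
proof -
  have "L-lipschitz_on UNIV (G k)"
    using G_lipschitz[OF assms] L_pos by (intro lipschitz_onI) (auto simp: dist_norm)
  then show ?thesis
    by (intro borel_measurable_continuous_onI lipschitz_on_continuous_on)
qed

abbreviation "f' \<equiv> fed_grad G K"

lemma fed_grad_lipschitz: "norm (f' x - f' y) \<le> L * norm (x - y)"
proof -
  have "norm (f' x - f' y) = (1 / real K) * norm (\<Sum>k<K. G k x - G k y)"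
    unfolding fed_grad_def by (simp add: sum_subtractf flip: scaleR_diff_right)
  also have "\<dots> \<le> (1 / real K) * (\<Sum>k<K. L * norm (x - y))"
    by (intro mult_left_mono sum_norm_le G_lipschitz) auto
  finally show ?thesis using K_pos by simp
qed

lemma fed_grad_measurable: "f' \<in> borel_measurable borel"
proof -
  have "L-lipschitz_on UNIV f'"
    using fed_grad_lipschitz L_pos by (intro lipschitz_onI) (auto simp: dist_norm)
  then show ?thesis
    by (intro borel_measurable_continuous_onI lipschitz_on_continuous_on)
qed

lemma fed_obj_deriv: "(fed_obj F K has_derivative (\<lambda>h. f' x \<bullet> h)) (at x)"
proof -
  have "((\<lambda>x. (1 / real K) * (\<Sum>k<K. F k x)) has_derivative (\<lambda>h. (1 / real K) * (\<Sum>k<K. G k x \<bullet> h))) (at x)"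
    by (intro has_derivative_mult_right has_derivative_sum F_deriv) auto
  then show ?thesis unfolding fed_obj_def[abs_def] fed_grad_def by (simp add: inner_sum_left)
qed

lemma fed_grad_hetero:
  assumes "k < K"
  shows "(norm (G k x - f' x))\<^sup>2 \<le> \<zeta>\<^sup>2"
proof -
  \<comment> \<open>Averaging over \<open>l\<close> makes this a mean of pairwise differences, to
    which the heterogeneity bound applies term by term.\<close>
  have "G k x - f' x = (1 / real (card {..<K})) *\<^sub>R (\<Sum>l<K. G k x - G l x)"
    using K_pos unfolding fed_grad_def by (simp add: sum_subtractf algebra_simps sum_constant_scaleR)
  then have "(norm (G k x - f' x))\<^sup>2 \<le> (1 / real (card {..<K})) * (\<Sum>l<K. (norm (G k x - G l x))\<^sup>2)"
    using norm_mean_sq_le[of "{..<K}" "\<lambda>l. G k x - G l x"] by simp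
  also have "\<dots> \<le> (1 / real (card {..<K})) * (\<Sum>l<K. \<zeta>\<^sup>2)"
    using G_hetero assms by (intro mult_left_mono sum_mono) auto
  finally show ?thesis using K_pos by simp
qed

section \<open>Random vectors determined by a set of samples\<close>

abbreviation sample :: "nat \<times> nat \<times> nat \<Rightarrow> 'm \<Rightarrow> 'a" where
  "sample \<equiv> \<lambda>(t, k, j). \<xi> t k j"

text \<open>Measurability with respect to the samples in \<open>A\<close>, in the Doob-Dynkin form
  of an explicit measurable factor. Independence can then be used by pushing joint laws forward
  along \<open>h\<close>. The restriction to \<open>A\<close> makes the argument a point of the
  product space.\<close>

definition determined :: "(nat \<times> nat \<times> nat) set \<Rightarrow> ('m \<Rightarrow> 'e::euclidean_space) \<Rightarrow> bool" where
  "determined A X \<longleftrightarrow> (\<exists>h \<in> borel_measurable (PiM A (\<lambda>_. S)). \<forall>\<omega>. X \<omega> = h (\<lambda>i\<in>A. sample i \<omega>))"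

abbreviation "indices \<equiv> {(t :: nat, k, j). k < K \<and> j < b}"

lemma determinedI:
  assumes "h \<in> borel_measurable (PiM A (\<lambda>_. S))" "\<And>\<omega>. X \<omega> = h (\<lambda>i\<in>A. sample i \<omega>)"
  shows "determined A X"
  unfolding determined_def by (intro bexI[of _ h] allI assms)

lemma determinedE:
  assumes "determined A X"
  obtains h where "h \<in> borel_measurable (PiM A (\<lambda>_. S))" "\<And>\<omega>. X \<omega> = h (\<lambda>i\<in>A. sample i \<omega>)"
  using assms unfolding determined_def by (elim bexE) (rule that, assumption, erule spec)

lemma determined_const: "determined A (\<lambda>\<omega>. c)"
  by (rule determinedI[of "\<lambda>_. c"]) auto

lemma determined_compose:
  assumes "determined A X" "h \<in> borel_measurable borel"
  shows "determined A (\<lambda>\<omega>. h (X \<omega>))"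
  using assms(1)
proof (rule determinedE)
  fix p assume "p \<in> borel_measurable (PiM A (\<lambda>_. S))" "\<And>\<omega>. X \<omega> = p (\<lambda>i\<in>A. sample i \<omega>)"
  then show ?thesis
    using assms(2) by (intro determinedI[of "\<lambda>s. h (p s)"]) auto
qed

lemma determined_add:
  assumes "determined A X" "determined A Y"
  shows "determined A (\<lambda>\<omega>. X \<omega> + Y \<omega>)"
proof -
  obtain p where p: "p \<in> borel_measurable (PiM A (\<lambda>_. S))" "\<And>\<omega>. X \<omega> = p (\<lambda>i\<in>A. sample i \<omega>)"
    using assms(1) by (rule determinedE) (rule that)
  obtain q where q: "q \<in> borel_measurable (PiM A (\<lambda>_. S))" "\<And>\<omega>. Y \<omega> = q (\<lambda>i\<in>A. sample i \<omega>)"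
    using assms(2) by (rule determinedE) (rule that)
  show ?thesis
    using p q by (intro determinedI[of "\<lambda>s. p s + q s"]) auto
qed

lemma determined_scaleR: "determined A X \<Longrightarrow> determined A (\<lambda>\<omega>. c *\<^sub>R X \<omega>)"
  by (rule determined_compose[where h = "\<lambda>x. c *\<^sub>R x"]) auto

lemma determined_diff:
  "determined A X \<Longrightarrow> determined A Y \<Longrightarrow> determined A (\<lambda>\<omega>. X \<omega> - Y \<omega>)"
  using determined_add[of A X "\<lambda>\<omega>. (-1) *\<^sub>R Y \<omega>"] determined_scaleR[of A Y "-1"] by simp

lemma determined_sum:
  "(\<And>i. i \<in> B \<Longrightarrow> determined A (X i)) \<Longrightarrow> determined A (\<lambda>\<omega>. \<Sum>i\<in>B. X i \<omega>)"
  by (induction B rule: infinite_finite_induct) (auto intro!: determined_add determined_const)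

lemma determined_g:
  assumes X: "determined A X" and k: "k < K" and i: "(t, l, j) \<in> A"
  shows "determined A (\<lambda>\<omega>. g k (X \<omega>) (\<xi> t l j \<omega>))"
proof -
  obtain p where p: "p \<in> borel_measurable (PiM A (\<lambda>_. S))" "\<And>\<omega>. X \<omega> = p (\<lambda>i\<in>A. sample i \<omega>)"
    using X by (rule determinedE) (rule that)
  have "(\<lambda>s. s (t, l, j)) \<in> measurable (PiM A (\<lambda>_. S)) S"
    using i by (rule measurable_component_singleton)
  from measurable_compose[OF measurable_Pair[OF p(1) this] g_measurable[OF k]] show ?thesis
    using p i by (intro determinedI[of "\<lambda>s. g k (p s) (s (t, l, j))"]) auto
qed

lemma determined_mono:
  assumes "determined A X" "A \<subseteq> B"
  shows "determined B X"
proof -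
  obtain p where p: "p \<in> borel_measurable (PiM A (\<lambda>_. S))" "\<And>\<omega>. X \<omega> = p (\<lambda>i\<in>A. sample i \<omega>)"
    using assms(1) by (rule determinedE) (rule that)
  show ?thesis
  proof (rule determinedI)
    \<comment> \<open>The new factor forgets the additional samples before applying the old
      one.\<close>
    show "(\<lambda>s. p (restrict s A)) \<in> borel_measurable (PiM B (\<lambda>_. S))"
      by (rule measurable_compose[OF measurable_restrict_subset[OF assms(2)] p(1)])
    fix \<omega>
    have "restrict (\<lambda>i\<in>B. sample i \<omega>) A = (\<lambda>i\<in>A. sample i \<omega>)"
      using assms(2) by (auto simp: restrict_def fun_eq_iff)
    then show "X \<omega> = p (restrict (\<lambda>i\<in>B. sample i \<omega>) A)" using p(2) by simp
  qed
qed

text \<open>Disjoint blocks of an independent family are independent: here the samples in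
  \<open>A\<close> and the single sample \<open>(t, k, j)\<close>. The product form of their joint
  law survives the pushforward by \<open>h\<close> and by the coordinate projection. The target
  space \<open>N\<close> is arbitrary because it will be both a vector space and a space of
  pairs.\<close>

lemma pair_distr_sample:
  assumes h[measurable]: "h \<in> measurable (PiM A (\<lambda>_. S)) N" and A: "A \<subseteq> indices"
    and i: "k < K" "j < b" "(t, k, j) \<notin> A"
    and Y: "\<And>\<omega>. Y \<omega> = h (\<lambda>i\<in>A. sample i \<omega>)"
  shows "Y \<in> measurable M N"
    and "distr M N Y \<Otimes>\<^sub>M D k = distr M (N \<Otimes>\<^sub>M S) (\<lambda>\<omega>. (Y \<omega>, \<xi> t k j \<omega>))"
proof -
  let ?U = "\<lambda>B \<omega>. \<lambda>i\<in>B. sample i \<omega>" and ?P = "\<lambda>B. PiM B (\<lambda>_. S)" and ?i = "{(t, k, j)}"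
  have "indep_var (?P A) (?U A) (?P ?i) (?U ?i)"
    using A i by (intro indep_var_restrict[OF samples_indep]) auto
  then have [measurable]: "?U A \<in> measurable M (?P A)" "?U ?i \<in> measurable M (?P ?i)"
    and eq: "distr M (?P A) (?U A) \<Otimes>\<^sub>M distr M (?P ?i) (?U ?i) = distr M (?P A \<Otimes>\<^sub>M ?P ?i) (\<lambda>\<omega>. (?U A \<omega>, ?U ?i \<omega>))"
    unfolding indep_var_distribution_eq by blast+
  have Y': "Y = (\<lambda>\<omega>. h (?U A \<omega>))" by (rule ext) (rule Y)
  show [measurable]: "Y \<in> measurable M N" unfolding Y' by measurable
  have [measurable]: "\<xi> t k j \<in> measurable M S" by (rule sample_measurable[OF i(1,2)])
  have [measurable]: "(\<lambda>s. s (t, k, j)) \<in> measurable (?P ?i) S"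
    by (rule measurable_component_singleton) simp
  have 1: "distr M N Y = distr (distr M (?P A) (?U A)) N h"
    unfolding Y' by (subst distr_distr) (auto simp: comp_def)
  have 2: "D k = distr (distr M (?P ?i) (?U ?i)) S (\<lambda>s. s (t, k, j))"
    unfolding distr_sample[OF i(1,2), of t, symmetric] by (subst distr_distr) (auto simp: comp_def)
  have sf: "sigma_finite_measure (distr (distr M (?P ?i) (?U ?i)) S (\<lambda>s. s (t, k, j)))"
    using prob_D[OF i(1)] unfolding 2[symmetric] by (simp add: prob_space_imp_sigma_finite)
  have "distr M N Y \<Otimes>\<^sub>M D k = distr (distr M (?P A) (?U A) \<Otimes>\<^sub>M distr M (?P ?i) (?U ?i))
      (N \<Otimes>\<^sub>M S) (\<lambda>(u, s). (h u, s (t, k, j)))"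
    unfolding 1 2 using sf by (intro pair_measure_distr) auto
  also have "\<dots> = distr M (N \<Otimes>\<^sub>M S) (\<lambda>\<omega>. (Y \<omega>, \<xi> t k j \<omega>))"
    unfolding eq by (subst distr_distr) (auto simp: comp_def Y')
  finally show "distr M N Y \<Otimes>\<^sub>M D k = distr M (N \<Otimes>\<^sub>M S) (\<lambda>\<omega>. (Y \<omega>, \<xi> t k j \<omega>))" .
qed

text \<open>The joint law of \<open>X\<close> and the fresh sample is a product, so Tonelli
  integrates over the sample first with the point held fixed. There the variance assumption applies,
  uniformly in the point.\<close>

lemma noise_variance:
  assumes X: "determined A X" and A: "A \<subseteq> indices" and i: "k < K" "j < b" "(t, k, j) \<notin> A"
  shows "sq_integrable M (\<lambda>\<omega>. g k (X \<omega>) (\<xi> t k j \<omega>) - G k (X \<omega>))"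
    and "expectation (\<lambda>\<omega>. (norm (g k (X \<omega>) (\<xi> t k j \<omega>) - G k (X \<omega>)))\<^sup>2) \<le> \<sigma>\<^sup>2"
proof -
  obtain p where p: "p \<in> borel_measurable (PiM A (\<lambda>_. S))" "\<And>\<omega>. X \<omega> = p (\<lambda>i\<in>A. sample i \<omega>)"
    using X by (rule determinedE) (rule that)
  note eq = pair_distr_sample(2)[OF p(1) A i p(2)] and [measurable] = pair_distr_sample(1)[OF p(1) A i p(2)]
  note [measurable] = sample_measurable[OF i(1,2)]
  note [measurable] = g_measurable[OF i(1)] G_measurable[OF i(1)]
  interpret Dk: prob_space "D k" using prob_D[OF i(1)] .
  have [measurable_cong]: "sets (D k) = sets S" using sets_D[OF i(1)] .
  interpret PX: prob_space "distr M borel X" by (rule prob_space_distr) simp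
  define q where "q = (\<lambda>(x, z). norm (g k x z - G k x))"
  \<comment> \<open>Measurability is known for the uncurried stochastic gradient, jointly in point
    and sample; \<open>q\<close> is rewritten to expose that function.\<close>
  have q_eq: "q = (\<lambda>p. norm ((\<lambda>(x, z). g k x z) p - G k (fst p)))"
    by (auto simp: q_def)
  have q[measurable]: "q \<in> borel_measurable (borel \<Otimes>\<^sub>M S)"
    unfolding q_eq by measurable
  have q'[measurable]: "q \<in> borel_measurable (distr M borel X \<Otimes>\<^sub>M D k)"
    by measurable
  have meas: "(\<lambda>\<omega>. (\<lambda>(x, z). g k x z) (X \<omega>, \<xi> t k j \<omega>) - G k (X \<omega>)) \<in> borel_measurable M"
    by measurable
  have "(\<integral>\<^sup>+ \<omega>. ennreal ((q (X \<omega>, \<xi> t k j \<omega>))\<^sup>2) \<partial>M)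
      = (\<integral>\<^sup>+ p. ennreal ((q p)\<^sup>2) \<partial>(distr M borel X \<Otimes>\<^sub>M D k))"
    unfolding eq by (subst nn_integral_distr) auto
  also have "\<dots> = (\<integral>\<^sup>+ x. \<integral>\<^sup>+ z. ennreal ((q (x, z))\<^sup>2) \<partial>D k \<partial>distr M borel X)"
    by (subst Dk.nn_integral_fst[symmetric]) auto
  also have "\<dots> \<le> (\<integral>\<^sup>+ x. ennreal (\<sigma>\<^sup>2) \<partial>distr M borel X)"
    using g_variance[OF i(1)] by (intro nn_integral_mono) (simp add: q_def)
  also have "\<dots> = ennreal (\<sigma>\<^sup>2)" using PX.emeasure_space_1 by simp
  finally have "(\<integral>\<^sup>+ \<omega>. ennreal ((norm (g k (X \<omega>) (\<xi> t k j \<omega>) - G k (X \<omega>)))\<^sup>2) \<partial>M) \<le> ennreal (\<sigma>\<^sup>2)"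
    by (simp add: q_def)
  with meas integrable_of_nn_integral_le[OF _ _ this]
  show "sq_integrable M (\<lambda>\<omega>. g k (X \<omega>) (\<xi> t k j \<omega>) - G k (X \<omega>))"
    and "expectation (\<lambda>\<omega>. (norm (g k (X \<omega>) (\<xi> t k j \<omega>) - G k (X \<omega>)))\<^sup>2) \<le> \<sigma>\<^sup>2"
    by (auto simp: sq_integrable_def)
qed

text \<open>With the pair \<open>(V, X)\<close> held fixed, the fresh sample integrates the noise to
  zero by unbiasedness; Fubini does the rest.\<close>

lemma noise_orthogonal:
  fixes X V :: "'m \<Rightarrow> 'd"
  assumes X: "determined A X" and V: "determined A V" and A: "A \<subseteq> indices"
    and i: "k < K" "j < b" "(t, k, j) \<notin> A" and sq: "sq_integrable M V"
  shows "expectation (\<lambda>\<omega>. V \<omega> \<bullet> (g k (X \<omega>) (\<xi> t k j \<omega>) - G k (X \<omega>))) = 0"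
proof -
  let ?P = "distr M (borel \<Otimes>\<^sub>M borel) (\<lambda>\<omega>. (V \<omega>, X \<omega>))"
  obtain p where p: "p \<in> borel_measurable (PiM A (\<lambda>_. S))" "\<And>\<omega>. X \<omega> = p (\<lambda>i\<in>A. sample i \<omega>)"
    using X by (rule determinedE) (rule that)
  obtain v where v: "v \<in> borel_measurable (PiM A (\<lambda>_. S))" "\<And>\<omega>. V \<omega> = v (\<lambda>i\<in>A. sample i \<omega>)"
    using V by (rule determinedE) (rule that)
  have pq: "(\<lambda>u. (v u, p u)) \<in> measurable (PiM A (\<lambda>_. S)) (borel \<Otimes>\<^sub>M borel)"
    using v(1) p(1) by (rule measurable_Pair)
  have VX: "(V \<omega>, X \<omega>) = (v (\<lambda>i\<in>A. sample i \<omega>), p (\<lambda>i\<in>A. sample i \<omega>))" for \<omega>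
    using p v by simp
  note eq = pair_distr_sample(2)[OF pq A i VX] and [measurable] = pair_distr_sample(1)[OF pq A i VX]
  note [measurable] = sample_measurable[OF i(1,2)]
  note [measurable] = g_measurable[OF i(1)] G_measurable[OF i(1)]
  interpret Dk: prob_space "D k" using prob_D[OF i(1)] .
  have [measurable_cong]: "sets (D k) = sets S" using sets_D[OF i(1)] .
  interpret PX: prob_space ?P by (rule prob_space_distr) simp
  interpret pair_sigma_finite ?P "D k" ..
  define q where "q = (\<lambda>((v, x), z). v \<bullet> (g k x z - G k x))"
  have q_eq: "q = (\<lambda>p. fst (fst p) \<bullet> ((\<lambda>(x, z). g k x z) (snd (fst p), snd p) - G k (snd (fst p))))"
    by (auto simp: q_def)
  have q[measurable]: "q \<in> borel_measurable ((borel \<Otimes>\<^sub>M borel) \<Otimes>\<^sub>M S)"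
    unfolding q_eq by measurable
  \<comment> \<open>Fubini needs integrability on the product space; it comes from square
    integrability of both factors and is carried over by the equality of laws.\<close>
  have "integrable M (\<lambda>\<omega>. q ((V \<omega>, X \<omega>), \<xi> t k j \<omega>))"
    unfolding q_def prod.case
    by (rule sq_integrable_inner[OF sq noise_variance(1)[OF X A i]])
  then have int: "integrable (?P \<Otimes>\<^sub>M D k) q"
    unfolding eq by (subst integrable_distr_eq) auto
  have "expectation (\<lambda>\<omega>. q ((V \<omega>, X \<omega>), \<xi> t k j \<omega>)) = integral\<^sup>L (?P \<Otimes>\<^sub>M D k) q"
    unfolding eq by (subst integral_distr) auto
  also have "\<dots> = (\<integral>p. (\<integral>z. q (p, z) \<partial>D k) \<partial>?P)"
    using integral_fst'[OF int] by simp
  also have "\<dots> = (\<integral>p. 0 \<partial>?P)"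
  proof (rule Bochner_Integration.integral_cong)
    fix p :: "'d \<times> 'd"
    obtain v x where p: "p = (v, x)" by (cases p)
    show "(\<integral>z. q (p, z) \<partial>D k) = 0"
      using g_integrable[OF i(1)] g_unbiased[OF i(1)]
      by (simp add: p q_def Dk.prob_space)
  qed simp
  finally show ?thesis by (simp add: q_def)
qed

section \<open>Iterates and noise\<close>

definition x :: "nat \<Rightarrow> nat \<Rightarrow> 'm \<Rightarrow> 'd" where
  "x t k \<omega> = fedavg_x g \<eta> I b K x1 (\<lambda>t k j. \<xi> t k j \<omega>) t k"

definition xbar :: "nat \<Rightarrow> 'm \<Rightarrow> 'd" where
  "xbar t \<omega> = fedavg_bar g \<eta> I b K x1 (\<lambda>t k j. \<xi> t k j \<omega>) t"

definition noise :: "nat \<Rightarrow> nat \<Rightarrow> nat \<Rightarrow> 'm \<Rightarrow> 'd" where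
  "noise t k j \<omega> = g k (x t k \<omega>) (\<xi> t k j \<omega>) - G k (x t k \<omega>)"

definition dir :: "nat \<Rightarrow> nat \<Rightarrow> 'm \<Rightarrow> 'd" where
  "dir t k \<omega> = (1 / real b) *\<^sub>R (\<Sum>j<b. g k (x t k \<omega>) (\<xi> t k j \<omega>))"

definition gbar :: "nat \<Rightarrow> 'm \<Rightarrow> 'd" where
  "gbar t \<omega> = (1 / real K) *\<^sub>R (\<Sum>k<K. G k (x t k \<omega>))"

text \<open>The sum runs over pairs, not over two nested indices, so that orthogonality of all
  \<open>b K\<close> noise terms applies to one index set.\<close>

definition mean_noise :: "nat \<Rightarrow> 'm \<Rightarrow> 'd" where
  "mean_noise t \<omega> = (1 / (real K * real b)) *\<^sub>R (\<Sum>(k, j)\<in>{..<K} \<times> {..<b}. noise t k j \<omega>)"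

definition consensus :: "nat \<Rightarrow> 'm \<Rightarrow> real" where
  "consensus t \<omega> = (1 / real K) * (\<Sum>k<K. (norm (x t k \<omega> - xbar t \<omega>))\<^sup>2)"

lemma x_0: "x 0 k \<omega> = x1" and x_1: "x (Suc 0) k \<omega> = x1"
  by (simp_all add: x_def)

lemma x_Suc:
  assumes "t \<noteq> 0"
  shows "x (Suc t) k \<omega> = (if t mod I = 0 then (1 / real K) *\<^sub>R (\<Sum>j<K. x t j \<omega> - \<eta> *\<^sub>R dir t j \<omega>)
           else x t k \<omega> - \<eta> *\<^sub>R dir t k \<omega>)"
  using assms by (simp add: x_def dir_def Let_def)

lemma xbar_eq: "xbar t \<omega> = (1 / real K) *\<^sub>R (\<Sum>k<K. x t k \<omega>)"
  by (simp add: xbar_def fedavg_bar_def x_def)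

lemma xbar_1: "xbar (Suc 0) \<omega> = x1"
  using K_pos by (simp add: xbar_eq x_1 sum_constant_scaleR)

lemma dir_eq: "dir t k \<omega> = G k (x t k \<omega>) + (1 / real b) *\<^sub>R (\<Sum>j<b. noise t k j \<omega>)"
  using b_pos by (simp add: dir_def noise_def sum_subtractf scaleR_diff_right sum_constant_scaleR)

lemma mean_dir_eq: "(1 / real K) *\<^sub>R (\<Sum>k<K. dir t k \<omega>) = gbar t \<omega> + mean_noise t \<omega>"
proof -
  have "(\<Sum>k<K. (1 / real b) *\<^sub>R (\<Sum>j<b. noise t k j \<omega>))
      = (1 / real b) *\<^sub>R (\<Sum>(k, j)\<in>{..<K} \<times> {..<b}. noise t k j \<omega>)"
    by (simp add: scaleR_sum_right sum.cartesian_product case_prod_beta)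
  then show ?thesis
    unfolding dir_eq sum.distrib gbar_def mean_noise_def by (simp add: scaleR_add_right)
qed

text \<open>Synchronisation replaces the iterates by their mean and thus leaves the mean unchanged,
  so the same recursion holds at every step.\<close>

lemma xbar_Suc:
  assumes "t \<noteq> 0"
  shows "xbar (Suc t) \<omega> = xbar t \<omega> - \<eta> *\<^sub>R (gbar t \<omega> + mean_noise t \<omega>)"
proof -
  have "xbar (Suc t) \<omega> = (1 / real K) *\<^sub>R (\<Sum>k<K. x t k \<omega> - \<eta> *\<^sub>R dir t k \<omega>)"
    unfolding xbar_eq[of "Suc t"] x_Suc[OF assms] using K_pos by (cases "t mod I = 0") (auto simp: sum_constant_scaleR)
  also have "\<dots> = xbar t \<omega> - \<eta> *\<^sub>R ((1 / real K) *\<^sub>R (\<Sum>k<K. dir t k \<omega>))"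
    unfolding xbar_eq by (simp add: sum_subtractf scaleR_diff_right mult.commute flip: scaleR_sum_right)
  finally show ?thesis unfolding mean_dir_eq .
qed

text \<open>The inequality is strict: iterates at time \<open>t\<close> depend on earlier
  minibatches only, so every sample of time \<open>t\<close> is still fresh.\<close>

definition past :: "nat \<Rightarrow> (nat \<times> nat \<times> nat) set" where
  "past t = {(s, k, j). s < t \<and> k < K \<and> j < b}"

lemma past_subset: "past t \<subseteq> indices" and past_mono: "past t \<subseteq> past (Suc t)"
  and not_in_past: "(t, k, j) \<notin> past t"
  by (auto simp: past_def)

lemma x_determined: "k < K \<Longrightarrow> determined (past t) (x t k)"
proof (induction t arbitrary: k)
  case 0
  then show ?case by (simp add: x_0[abs_def] determined_const)
next
  case (Suc t)
  show ?case
  proof (cases "t = 0")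
    case True
    then show ?thesis by (simp add: x_1[abs_def] determined_const)
  next
    case False
    have d: "determined (past (Suc t)) (x t k)" if "k < K" for k
      by (rule determined_mono[OF Suc.IH[OF that] past_mono])
    have "determined (past (Suc t)) (\<lambda>\<omega>. x t k \<omega> - \<eta> *\<^sub>R dir t k \<omega>)" if "k < K" for k
      unfolding dir_def using that
      by (intro determined_diff d determined_scaleR determined_sum determined_g) (auto simp: past_def)
    with Suc.prems show ?thesis unfolding x_Suc[OF False, abs_def]
      by (cases "t mod I = 0") (auto intro!: determined_scaleR determined_sum)
  qed
qed

lemma noise_sq_integrable: "k < K \<Longrightarrow> j < b \<Longrightarrow> sq_integrable M (noise t k j)"
  and noise_variance_le: "k < K \<Longrightarrow> j < b \<Longrightarrow> expectation (\<lambda>\<omega>. (norm (noise t k j \<omega>))\<^sup>2) \<le> \<sigma>\<^sup>2"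
  unfolding noise_def[abs_def] by (rule noise_variance[OF x_determined past_subset]; simp add: not_in_past)+

lemma noise_determined:
  assumes "k < K" "j < b"
  shows "determined (insert (t, k, j) (past t)) (noise t k j)"
proof -
  have "determined (insert (t, k, j) (past t)) (x t k)"
    by (rule determined_mono[OF x_determined]) (use assms in auto)
  then show ?thesis unfolding noise_def[abs_def]
    using assms by (intro determined_diff determined_g determined_compose[OF _ G_measurable]) auto
qed

text \<open>Adjoin the sample \<open>(t, k, j)\<close> to the past: this determines the first noise
  term, while the sample of the second one remains fresh.\<close>

lemma noise_uncorrelated:
  assumes "k < K" "j < b" "l < K" "i < b" "(k, j) \<noteq> (l, i)"
  shows "expectation (\<lambda>\<omega>. noise t k j \<omega> \<bullet> noise t l i \<omega>) = 0"
  unfolding noise_def[of t l i]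
proof (rule noise_orthogonal)
  show "determined (insert (t, k, j) (past t)) (x t l)"
    by (rule determined_mono[OF x_determined]) (use assms in auto)
  show "determined (insert (t, k, j) (past t)) (noise t k j)"
    by (rule noise_determined) (use assms in auto)
  show "insert (t, k, j) (past t) \<subseteq> indices" using past_subset assms by auto
  show "(t, l, i) \<notin> insert (t, k, j) (past t)" using assms not_in_past by auto
qed (use assms in \<open>auto intro: noise_sq_integrable\<close>)

lemma mean_noise_sq_integrable: "sq_integrable M (mean_noise t)"
  unfolding mean_noise_def[abs_def]
  by (intro sq_integrable_scaleR sq_integrable_sum) (auto intro: noise_sq_integrable)

text \<open>Uncorrelatedness makes the second moment of the sum at most
  \<open>b K \<sigma>^2\<close>, and the scaling divides it by \<open>(b K)^2\<close>. This is the
  linear speedup in the number of workers.\<close>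

lemma mean_noise_variance:
  "expectation (\<lambda>\<omega>. (norm (mean_noise t \<omega>))\<^sup>2) \<le> \<sigma>\<^sup>2 / (real b * real K)"
proof -
  let ?A = "{..<K} \<times> {..<b}" and ?N = "\<lambda>p. noise t (fst p) (snd p)"
  have "expectation (\<lambda>\<omega>. (norm (\<Sum>p\<in>?A. ?N p \<omega>))\<^sup>2) = (\<Sum>p\<in>?A. expectation (\<lambda>\<omega>. (norm (?N p \<omega>))\<^sup>2))"
    by (rule norm_sq_sum_orthogonal) (auto intro!: noise_sq_integrable noise_uncorrelated)
  also have "\<dots> \<le> (\<Sum>p\<in>?A. \<sigma>\<^sup>2)"
    by (intro sum_mono noise_variance_le) auto
  finally have le: "expectation (\<lambda>\<omega>. (norm (\<Sum>p\<in>?A. ?N p \<omega>))\<^sup>2) \<le> real K * real b * \<sigma>\<^sup>2" by simp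
  have "expectation (\<lambda>\<omega>. (norm (mean_noise t \<omega>))\<^sup>2)
      = (1 / (real K * real b))\<^sup>2 * expectation (\<lambda>\<omega>. (norm (\<Sum>p\<in>?A. ?N p \<omega>))\<^sup>2)"
    unfolding mean_noise_def case_prod_beta norm_scaleR power_mult_distrib by simp
  also have "\<dots> \<le> (1 / (real K * real b))\<^sup>2 * (real K * real b * \<sigma>\<^sup>2)"
    by (rule mult_left_mono[OF le]) simp
  also have "\<dots> = \<sigma>\<^sup>2 / (real b * real K)"
    using K_pos b_pos by (simp add: power2_eq_square)
  finally show ?thesis .
qed

lemma mean_noise_orthogonal:
  assumes W: "determined (past t) W" "sq_integrable M W"
  shows "expectation (\<lambda>\<omega>. W \<omega> \<bullet> mean_noise t \<omega>) = 0"
proof -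
  let ?A = "{..<K} \<times> {..<b}"
  have z: "expectation (\<lambda>\<omega>. W \<omega> \<bullet> noise t k j \<omega>) = 0" if "k < K" "j < b" for k j
    unfolding noise_def using that W
    by (intro noise_orthogonal[OF x_determined W(1) past_subset]) (auto simp: not_in_past)
  have "expectation (\<lambda>\<omega>. W \<omega> \<bullet> mean_noise t \<omega>)
      = (1 / (real K * real b)) * expectation (\<lambda>\<omega>. \<Sum>p\<in>?A. W \<omega> \<bullet> noise t (fst p) (snd p) \<omega>)"
    unfolding mean_noise_def case_prod_beta inner_scaleR_right inner_sum_right by simp
  also have "expectation (\<lambda>\<omega>. \<Sum>p\<in>?A. W \<omega> \<bullet> noise t (fst p) (snd p) \<omega>)
      = (\<Sum>p\<in>?A. expectation (\<lambda>\<omega>. W \<omega> \<bullet> noise t (fst p) (snd p) \<omega>))"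
    by (rule Bochner_Integration.integral_sum)
       (auto intro!: sq_integrable_inner W noise_sq_integrable)
  also have "\<dots> = 0" by (rule sum.neutral) (auto simp: z)
  finally show ?thesis by simp
qed

section \<open>Square integrability of the iterates and bias of the averaged gradient\<close>

lemma dir_sq_integrable:
  "k < K \<Longrightarrow> sq_integrable M (x t k) \<Longrightarrow> sq_integrable M (dir t k)"
  unfolding dir_eq[abs_def]
  by (intro sq_integrable_add sq_integrable_scaleR sq_integrable_sum noise_sq_integrable
       sq_integrable_lipschitz[OF _ G_lipschitz G_measurable]) auto

lemma x_sq_integrable: "k < K \<Longrightarrow> sq_integrable M (x t k)"
proof (induction t arbitrary: k)
  case 0
  then show ?case by (simp add: x_0[abs_def] sq_integrable_const)
next
  case (Suc t)
  show ?case
  proof (cases "t = 0")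
    case True
    then show ?thesis by (simp add: x_1[abs_def] sq_integrable_const)
  next
    case False
    have "sq_integrable M (\<lambda>\<omega>. x t k \<omega> - \<eta> *\<^sub>R dir t k \<omega>)" if "k < K" for k
      using that Suc.IH by (intro sq_integrable_diff sq_integrable_scaleR dir_sq_integrable) auto
    with Suc.prems show ?thesis unfolding x_Suc[OF False, abs_def]
      by (cases "t mod I = 0") (auto intro!: sq_integrable_scaleR sq_integrable_sum)
  qed
qed

lemma xbar_sq_integrable: "sq_integrable M (xbar t)"
  unfolding xbar_eq[abs_def]
  by (intro sq_integrable_scaleR sq_integrable_sum) (auto intro: x_sq_integrable)

lemma xbar_determined: "determined (past t) (xbar t)"
  unfolding xbar_eq[abs_def]
  by (intro determined_scaleR determined_sum) (auto intro: x_determined)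

lemma gbar_sq_integrable: "sq_integrable M (gbar t)"
  unfolding gbar_def[abs_def]
  by (intro sq_integrable_scaleR sq_integrable_sum sq_integrable_lipschitz[OF _ G_lipschitz G_measurable])
     (auto intro: x_sq_integrable)

lemma gbar_determined: "determined (past t) (gbar t)"
  unfolding gbar_def[abs_def]
  by (intro determined_scaleR determined_sum determined_compose[OF _ G_measurable]) (auto intro: x_determined)

lemma grad_sq_integrable: "sq_integrable M (\<lambda>\<omega>. f' (xbar t \<omega>))"
  by (rule sq_integrable_lipschitz[OF xbar_sq_integrable fed_grad_lipschitz fed_grad_measurable])

lemma consensus_integrable: "integrable M (consensus t)"
  unfolding consensus_def[abs_def]
  by (intro Bochner_Integration.integrable_mult_right Bochner_Integration.integrable_sum
        sq_integrable_norm_sq sq_integrable_diff xbar_sq_integrable x_sq_integrable) auto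

lemma grad_gbar_le: "(norm (f' (xbar t \<omega>) - gbar t \<omega>))\<^sup>2 \<le> L\<^sup>2 * consensus t \<omega>"
proof -
  have "f' (xbar t \<omega>) - gbar t \<omega> = (1 / real (card {..<K})) *\<^sub>R (\<Sum>k<K. G k (xbar t \<omega>) - G k (x t k \<omega>))"
    unfolding fed_grad_def gbar_def by (simp add: sum_subtractf flip: scaleR_diff_right)
  then have "(norm (f' (xbar t \<omega>) - gbar t \<omega>))\<^sup>2
      \<le> (1 / real K) * (\<Sum>k<K. (norm (G k (xbar t \<omega>) - G k (x t k \<omega>)))\<^sup>2)"
    using norm_mean_sq_le[of "{..<K}" "\<lambda>k. G k (xbar t \<omega>) - G k (x t k \<omega>)"] by simp
  also have "\<dots> \<le> (1 / real K) * (\<Sum>k<K. L\<^sup>2 * (norm (x t k \<omega> - xbar t \<omega>))\<^sup>2)"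
  proof (intro mult_left_mono sum_mono)
    fix k assume "k \<in> {..<K}"
    then have "norm (G k (xbar t \<omega>) - G k (x t k \<omega>)) \<le> L * norm (x t k \<omega> - xbar t \<omega>)"
      using G_lipschitz[of k "xbar t \<omega>" "x t k \<omega>"] by (simp add: norm_minus_commute)
    from power_mono[OF this, of 2]
    show "(norm (G k (xbar t \<omega>) - G k (x t k \<omega>)))\<^sup>2 \<le> L\<^sup>2 * (norm (x t k \<omega> - xbar t \<omega>))\<^sup>2"
      by (simp add: power_mult_distrib)
  qed simp
  also have "\<dots> = L\<^sup>2 * consensus t \<omega>"
    unfolding consensus_def by (simp add: sum_distrib_left)
  finally show ?thesis .
qed

section \<open>Drift of the local iterates\<close>

text \<open>The spread of the local directions around their mean; up to the factor
  \<open>\<eta>^2\<close> it is the mean squared increment of the drift in one local step.\<close>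

definition dev :: "nat \<Rightarrow> 'm \<Rightarrow> real" where
  "dev t \<omega> = (1 / real K) * (\<Sum>k<K. (norm (dir t k \<omega> - (gbar t \<omega> + mean_noise t \<omega>)))\<^sup>2)"

lemma dev_integrable: "integrable M (dev t)"
  unfolding dev_def[abs_def]
  by (intro Bochner_Integration.integrable_mult_right Bochner_Integration.integrable_sum
        sq_integrable_norm_sq sq_integrable_diff sq_integrable_add gbar_sq_integrable mean_noise_sq_integrable
        dir_sq_integrable x_sq_integrable) auto

text \<open>The centre is moved from the mean direction to the global gradient at
  \<open>xbar\<close>, which can only increase the sum. The rest splits into sampling noise, the
  distance of the local iterate from \<open>xbar\<close>, and heterogeneity at the common
  point.\<close>

lemma dev_le:
  "dev t \<omega> \<le> 3 * ((1 / real K) * (\<Sum>k<K. (1 / real b) * (\<Sum>j<b. (norm (noise t k j \<omega>))\<^sup>2))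
      + L\<^sup>2 * consensus t \<omega> + \<zeta>\<^sup>2)"
proof -
  have le: "(norm (dir t k \<omega> - f' (xbar t \<omega>)))\<^sup>2 \<le> 3 * ((1 / real b) * (\<Sum>j<b. (norm (noise t k j \<omega>))\<^sup>2)
      + L\<^sup>2 * (norm (x t k \<omega> - xbar t \<omega>))\<^sup>2 + \<zeta>\<^sup>2)" if k: "k < K" for k
  proof -
    have "dir t k \<omega> - f' (xbar t \<omega>) = (1 / real b) *\<^sub>R (\<Sum>j<b. noise t k j \<omega>)
        + (G k (x t k \<omega>) - G k (xbar t \<omega>)) + (G k (xbar t \<omega>) - f' (xbar t \<omega>))"
      unfolding dir_eq by simp
    then have a: "(norm (dir t k \<omega> - f' (xbar t \<omega>)))\<^sup>2 \<le> 3 * ((norm ((1 / real b) *\<^sub>R (\<Sum>j<b. noise t k j \<omega>)))\<^sup>2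
        + (norm (G k (x t k \<omega>) - G k (xbar t \<omega>)))\<^sup>2 + (norm (G k (xbar t \<omega>) - f' (xbar t \<omega>)))\<^sup>2)"
      using norm_add3_sq_le by metis
    \<comment> \<open>Convexity alone is used here, so the noise will contribute the full
      \<open>\<sigma>^2\<close> without a factor \<open>1 / b\<close>.\<close>
    have b: "(norm ((1 / real b) *\<^sub>R (\<Sum>j<b. noise t k j \<omega>)))\<^sup>2 \<le> (1 / real b) * (\<Sum>j<b. (norm (noise t k j \<omega>))\<^sup>2)"
      using norm_mean_sq_le[of "{..<b}" "\<lambda>j. noise t k j \<omega>"] by simp
    have c: "(norm (G k (x t k \<omega>) - G k (xbar t \<omega>)))\<^sup>2 \<le> L\<^sup>2 * (norm (x t k \<omega> - xbar t \<omega>))\<^sup>2"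
      using power_mono[OF G_lipschitz[OF k], of "x t k \<omega>" "xbar t \<omega>" 2] by (simp add: power_mult_distrib)
    have d: "(norm (G k (xbar t \<omega>) - f' (xbar t \<omega>)))\<^sup>2 \<le> \<zeta>\<^sup>2"
      by (rule fed_grad_hetero[OF k])
    show ?thesis by (rule order_trans[OF a]) (intro mult_left_mono add_mono b c d, simp)
  qed
  have "dev t \<omega> \<le> (1 / real K) * (\<Sum>k<K. (norm (dir t k \<omega> - f' (xbar t \<omega>)))\<^sup>2)"
    unfolding dev_def by (intro mult_left_mono sum_norm_sq_mean_le) (use K_pos in \<open>auto simp: mean_dir_eq\<close>)
  also have "\<dots> \<le> (1 / real K) * (\<Sum>k<K. 3 * ((1 / real b) * (\<Sum>j<b. (norm (noise t k j \<omega>))\<^sup>2)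
      + L\<^sup>2 * (norm (x t k \<omega> - xbar t \<omega>))\<^sup>2 + \<zeta>\<^sup>2))"
    using le by (intro mult_left_mono sum_mono) auto
  also have "\<dots> = 3 * ((1 / real K) * (\<Sum>k<K. (1 / real b) * (\<Sum>j<b. (norm (noise t k j \<omega>))\<^sup>2))
      + L\<^sup>2 * consensus t \<omega> + (1 / real K) * (real K * \<zeta>\<^sup>2))"
    unfolding consensus_def sum.distrib sum_distrib_left[symmetric] by (simp add: algebra_simps)
  finally show ?thesis using K_pos by simp
qed

lemma expectation_dev_le:
  "expectation (dev t) \<le> 3 * (\<sigma>\<^sup>2 + L\<^sup>2 * expectation (consensus t) + \<zeta>\<^sup>2)"
proof -
  define n where "n \<omega> = (1 / real K) * (\<Sum>k<K. (1 / real b) * (\<Sum>j<b. (norm (noise t k j \<omega>))\<^sup>2))" for \<omega>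
  have int: "integrable M n" unfolding n_def[abs_def]
    by (intro Bochner_Integration.integrable_mult_right Bochner_Integration.integrable_sum
        sq_integrable_norm_sq noise_sq_integrable) auto
  have "expectation n = (1 / real K) * (\<Sum>k<K. (1 / real b) * (\<Sum>j<b. expectation (\<lambda>\<omega>. (norm (noise t k j \<omega>))\<^sup>2)))"
    unfolding n_def by (subst integral_mult_right_zero, subst Bochner_Integration.integral_sum)
       (auto intro!: Bochner_Integration.integrable_sum sum.cong
          Bochner_Integration.integral_sum Bochner_Integration.integrable_divide sq_integrable_norm_sq noise_sq_integrable)
  also have "\<dots> \<le> (1 / real K) * (\<Sum>k<K. (1 / real b) * (\<Sum>j<b. \<sigma>\<^sup>2))"
    by (intro mult_left_mono sum_mono noise_variance_le) auto
  also have "\<dots> = \<sigma>\<^sup>2" using K_pos b_pos by simp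
  finally have n_le: "expectation n \<le> \<sigma>\<^sup>2" .
  have "expectation (dev t) \<le> expectation (\<lambda>\<omega>. 3 * (n \<omega> + L\<^sup>2 * consensus t \<omega> + \<zeta>\<^sup>2))"
    by (rule integral_mono[OF dev_integrable _ dev_le[of t, folded n_def]])
       (intro Bochner_Integration.integrable_mult_right Bochner_Integration.integrable_add int consensus_integrable, simp)
  also have "\<dots> = 3 * (expectation n + L\<^sup>2 * expectation (consensus t) + \<zeta>\<^sup>2)"
    using int consensus_integrable[of t] by (simp add: prob_space)
  finally show ?thesis using n_le by simp
qed

section \<open>Growth of the drift between synchronisations\<close>

lemma x_synchronised:
  assumes "s mod I = 0" "k < K"
  shows "x (Suc s) k \<omega> = xbar (Suc s) \<omega>"
\<comment> \<open>Time 1 counts as synchronised because \<open>0 mod I = 0\<close>; there the common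
  starting point takes the place of averaging.\<close>
proof (cases "s = 0")
  case True
  then show ?thesis by (simp add: x_1 xbar_1)
next
  case False
  then show ?thesis
    unfolding xbar_eq[of "Suc s"] x_Suc[OF False] using assms K_pos by (simp add: sum_constant_scaleR)
qed

lemma consensus_synchronised: "s mod I = 0 \<Longrightarrow> consensus (Suc s) \<omega> = 0"
  unfolding consensus_def by (simp add: x_synchronised)

lemma drift_Suc:
  assumes "t \<noteq> 0" "t mod I \<noteq> 0"
  shows "x (Suc t) k \<omega> - xbar (Suc t) \<omega>
    = (x t k \<omega> - xbar t \<omega>) - \<eta> *\<^sub>R (dir t k \<omega> - (gbar t \<omega> + mean_noise t \<omega>))"
  unfolding x_Suc[OF assms(1)] xbar_Suc[OF assms(1)] using assms(2) by (simp add: algebra_simps)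

lemma consensus_Suc_le:
  assumes "t \<noteq> 0" "t mod I \<noteq> 0" "r > 0"
  shows "consensus (Suc t) \<omega> \<le> (1 + 1 / r) * consensus t \<omega> + (1 + r) * (\<eta>\<^sup>2 * dev t \<omega>)"
proof -
  have "consensus (Suc t) \<omega> \<le> (1 / real K) * (\<Sum>k<K. (1 + 1 / r) * (norm (x t k \<omega> - xbar t \<omega>))\<^sup>2
      + (1 + r) * (norm (\<eta> *\<^sub>R (dir t k \<omega> - (gbar t \<omega> + mean_noise t \<omega>))))\<^sup>2)"
    unfolding consensus_def drift_Suc[OF assms(1,2)]
    by (intro mult_left_mono sum_mono norm_diff_sq_le_Young assms) auto
  also have "\<dots> = (1 + 1 / r) * consensus t \<omega> + (1 + r) * (\<eta>\<^sup>2 * dev t \<omega>)"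
    unfolding consensus_def dev_def norm_scaleR power_mult_distrib sum.distrib sum_distrib_left[symmetric]
    by (simp add: distrib_left mult.left_commute)
  finally show ?thesis .
qed

text \<open>With \<open>r\<close> local steps since the last synchronisation, Young's inequality with weights
  \<open>1 + 1/r\<close> and \<open>1 + r\<close> turns the bound \<open>r\<^sup>2 Q\<close> into exactly \<open>(r + 1)\<^sup>2 Q\<close>.\<close>

lemma expectation_consensus_le:
  "expectation (consensus (Suc s)) \<le> (real (s mod I))\<^sup>2 * (6 * \<eta>\<^sup>2 * (\<sigma>\<^sup>2 + \<zeta>\<^sup>2))"
proof (induction s)
  case 0
  then show ?case by (simp add: consensus_synchronised)
next
  case (Suc s)
  let ?Q = "6 * \<eta>\<^sup>2 * (\<sigma>\<^sup>2 + \<zeta>\<^sup>2)" and ?r = "real (s mod I)"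
  show ?case
  proof (cases "Suc s mod I = 0")
    case True
    then show ?thesis by (simp add: consensus_synchronised)
  next
    case False
    have r: "real (Suc s mod I) = ?r + 1" using False by (simp add: mod_Suc split: if_splits)
    have rI: "?r \<le> real I" using I_pos by (simp add: less_imp_le)
    have "L\<^sup>2 * expectation (consensus (Suc s)) \<le> L\<^sup>2 * ((real I)\<^sup>2 * ?Q)"
      by (rule mult_left_mono[OF order_trans[OF Suc.IH]])
         (use rI in \<open>auto intro!: mult_right_mono power_mono\<close>)
    also have "\<dots> = (L\<^sup>2 * (real I)\<^sup>2 * \<eta>\<^sup>2) * (6 * (\<sigma>\<^sup>2 + \<zeta>\<^sup>2))" by (simp add: algebra_simps)
    \<comment> \<open>The step size condition gives the factor \<open>1 / 81\<close>, and
      \<open>1 / 6\<close> suffices: the drift then contributes at most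
      \<open>\<sigma>^2 + \<zeta>^2\<close> to \<open>dev\<close>, whose bound becomes
      \<open>3 * 2 * (\<sigma>^2 + \<zeta>^2)\<close>. This is where the 6 of the induction
      hypothesis comes from.\<close>
    also have "\<dots> \<le> (1 / 6) * (6 * (\<sigma>\<^sup>2 + \<zeta>\<^sup>2))"
      using step_small by (intro mult_right_mono) auto
    finally have "expectation (dev (Suc s)) \<le> 6 * (\<sigma>\<^sup>2 + \<zeta>\<^sup>2)"
      using expectation_dev_le[of "Suc s"] by simp
    from mult_left_mono[OF this, of "\<eta>\<^sup>2"]
    have d: "\<eta>\<^sup>2 * expectation (dev (Suc s)) \<le> ?Q" by (simp add: algebra_simps)
    show ?thesis
    proof (cases "s mod I = 0")
      \<comment> \<open>Directly after a synchronisation Young's inequality would need the weight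
        \<open>1 / 0\<close>; instead the drift equals the single increment exactly.\<close>
      case True
      have "consensus (Suc (Suc s)) = (\<lambda>\<omega>. \<eta>\<^sup>2 * dev (Suc s) \<omega>)"
        unfolding consensus_def[abs_def] dev_def using False True
        by (simp add: drift_Suc x_synchronised power_mult_distrib sum_distrib_left mult.left_commute)
      then have "expectation (consensus (Suc (Suc s))) = \<eta>\<^sup>2 * expectation (dev (Suc s))" by simp
      then show ?thesis using d True r by simp
    next
      case rpos: False
      then have r0: "?r > 0" by simp
      have "expectation (consensus (Suc (Suc s)))
          \<le> expectation (\<lambda>\<omega>. (1 + 1 / ?r) * consensus (Suc s) \<omega> + (1 + ?r) * (\<eta>\<^sup>2 * dev (Suc s) \<omega>))"
        using False r0
        by (intro integral_mono consensus_Suc_le Bochner_Integration.integrable_add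
             Bochner_Integration.integrable_mult_right consensus_integrable dev_integrable) auto
      also have "\<dots> = (1 + 1 / ?r) * expectation (consensus (Suc s)) + (1 + ?r) * (\<eta>\<^sup>2 * expectation (dev (Suc s)))"
        using consensus_integrable[of "Suc s"] dev_integrable[of "Suc s"] by simp
      also have "\<dots> \<le> (1 + 1 / ?r) * (?r\<^sup>2 * ?Q) + (1 + ?r) * ?Q"
        using Suc.IH d by (intro add_mono mult_left_mono) auto
      also have "\<dots> = (?r + 1)\<^sup>2 * ?Q"
        using r0 by (simp add: power2_eq_square field_simps)
      finally show ?thesis unfolding r .
    qed
  qed
qed

lemma expectation_consensus_le':
  assumes "t \<noteq> 0"
  shows "expectation (consensus t) \<le> 6 * \<eta>\<^sup>2 * (real I)\<^sup>2 * (\<sigma>\<^sup>2 + \<zeta>\<^sup>2)"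
proof -
  obtain s where t: "t = Suc s" using assms not0_implies_Suc by blast
  have "(real (s mod I))\<^sup>2 \<le> (real I)\<^sup>2" using I_pos by (intro power_mono) (auto simp: less_imp_le)
  from mult_right_mono[OF this, of "6 * \<eta>\<^sup>2 * (\<sigma>\<^sup>2 + \<zeta>\<^sup>2)"] expectation_consensus_le[of s]
  show ?thesis unfolding t by (simp add: algebra_simps)
qed

section \<open>Descent of the averaged iterate\<close>

text \<open>The step size condition is weakened by \<open>I \<ge> 1\<close>; this is what absorbs
  the second-order term of the descent inequality.\<close>

lemma eta_L_le: "L * \<eta> \<le> 1"
proof -
  have "1 \<le> (real I)\<^sup>2" using I_pos by (intro one_le_power) simp
  then have "(L * \<eta>)\<^sup>2 * 1 \<le> (L * \<eta>)\<^sup>2 * (81 * (real I)\<^sup>2)"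
    by (intro mult_left_mono) auto
  also have "\<dots> \<le> 1\<^sup>2" using step_small by (simp add: algebra_simps power_mult_distrib)
  finally have "(L * \<eta>)\<^sup>2 \<le> 1\<^sup>2" by simp
  then show ?thesis by (rule power2_le_imp_le) simp
qed

text \<open>The coefficient of the mean noise in the descent inequality.\<close>

definition probe :: "nat \<Rightarrow> 'm \<Rightarrow> 'd" where
  "probe t \<omega> = (L * \<eta>\<^sup>2) *\<^sub>R gbar t \<omega> - \<eta> *\<^sub>R f' (xbar t \<omega>)"

lemma probe_determined: "determined (past t) (probe t)"
  unfolding probe_def[abs_def]
  by (intro determined_diff determined_scaleR gbar_determined determined_compose[OF xbar_determined fed_grad_measurable])

lemma probe_sq_integrable: "sq_integrable M (probe t)"
  unfolding probe_def[abs_def]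
  by (intro sq_integrable_diff sq_integrable_scaleR gbar_sq_integrable grad_sq_integrable)

text \<open>Smooth descent is applied to the step \<open>-\<eta> (gbar + mean_noise)\<close>. All
  terms linear in the noise are gathered in \<open>probe\<close>, whose inner product with the noise
  has mean zero.\<close>

lemma descent_step:
  assumes "t \<noteq> 0"
  shows "\<eta> / 2 * (norm (f' (xbar t \<omega>)))\<^sup>2 \<le> fed_obj F K (xbar t \<omega>) - fed_obj F K (xbar (Suc t) \<omega>)
     + (\<eta> / 2 * L\<^sup>2 * consensus t \<omega> + probe t \<omega> \<bullet> mean_noise t \<omega> + L * \<eta>\<^sup>2 / 2 * (norm (mean_noise t \<omega>))\<^sup>2)"
proof -
  let ?v = "f' (xbar t \<omega>)" and ?u = "gbar t \<omega>" and ?n = "mean_noise t \<omega>"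
  have "fed_obj F K (xbar t \<omega> + - \<eta> *\<^sub>R (?u + ?n)) \<le> fed_obj F K (xbar t \<omega>)
      + ?v \<bullet> (- \<eta> *\<^sub>R (?u + ?n)) + L / 2 * (norm (- \<eta> *\<^sub>R (?u + ?n)))\<^sup>2"
    by (rule smooth_descent[OF fed_obj_deriv fed_grad_lipschitz])
  then have 1: "fed_obj F K (xbar (Suc t) \<omega>) \<le> fed_obj F K (xbar t \<omega>)
      - \<eta> * (?v \<bullet> ?u) - \<eta> * (?v \<bullet> ?n) + L * \<eta>\<^sup>2 / 2 * (norm ?u)\<^sup>2 + L * \<eta>\<^sup>2 * (?u \<bullet> ?n) + L * \<eta>\<^sup>2 / 2 * (norm ?n)\<^sup>2"
    unfolding xbar_Suc[OF assms] norm_scaleR power_mult_distrib power2_norm_eq_inner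
    by (simp add: inner_add_left inner_add_right inner_commute algebra_simps add_divide_distrib)
  \<comment> \<open>Polarisation trades the inner product for squares: one is the quantity to bound,
    one is the bias, and \<open>?u\<close> supplies a negative term.\<close>
  have 2: "\<eta> * (?v \<bullet> ?u) = \<eta> / 2 * (norm ?v)\<^sup>2 + \<eta> / 2 * (norm ?u)\<^sup>2 - \<eta> / 2 * (norm (?v - ?u))\<^sup>2"
    unfolding power2_norm_eq_inner
    by (simp add: inner_diff_left inner_diff_right inner_commute algebra_simps)
  have 3: "\<eta> / 2 * (norm (?v - ?u))\<^sup>2 \<le> \<eta> / 2 * (L\<^sup>2 * consensus t \<omega>)"
    using eta_pos by (intro mult_left_mono grad_gbar_le) auto
  \<comment> \<open>That negative term in \<open>?u\<close> outweighs the quadratic term of the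
    smoothness bound.\<close>
  have "(L * \<eta>) * \<eta> / 2 * (norm ?u)\<^sup>2 \<le> 1 * \<eta> / 2 * (norm ?u)\<^sup>2"
    using eta_L_le eta_pos by (intro mult_right_mono divide_right_mono) auto
  then have 4: "L * \<eta>\<^sup>2 / 2 * (norm ?u)\<^sup>2 \<le> \<eta> / 2 * (norm ?u)\<^sup>2" by (simp add: power2_eq_square mult.assoc)
  have 5: "probe t \<omega> \<bullet> ?n = L * \<eta>\<^sup>2 * (?u \<bullet> ?n) - \<eta> * (?v \<bullet> ?n)"
    unfolding probe_def by (simp add: inner_diff_left)
  show ?thesis using 1 2 3 4 5 by (simp add: mult.assoc)
qed

abbreviation "gap \<equiv> fed_obj F K x1 - fed_fstar F K"

lemma fstar_le: "fed_fstar F K \<le> fed_obj F K y"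
  unfolding fed_fstar_def by (rule cInf_lower[OF _ bdd_obj]) simp

text \<open>Telescoping happens pointwise and the last objective value is replaced by the infimum
  before integrating, so expectations of objective values never occur.\<close>

lemma gradient_sum_le:
  "(\<integral>\<^sup>+ \<omega>. ennreal (\<Sum>t\<in>{1..T}. (norm (f' (xbar t \<omega>)))\<^sup>2) \<partial>M)
     \<le> ennreal (2 / \<eta> * gap + real T * (6 * L\<^sup>2 * \<eta>\<^sup>2 * (real I)\<^sup>2 * (\<sigma>\<^sup>2 + \<zeta>\<^sup>2) + L * \<eta> * \<sigma>\<^sup>2 / (real b * real K)))"
    (is "_ \<le> ennreal (_ + real T * (?A + ?B))")
proof -
  define R where "R t \<omega> = L\<^sup>2 * consensus t \<omega> + 2 / \<eta> * (probe t \<omega> \<bullet> mean_noise t \<omega>)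
      + L * \<eta> * (norm (mean_noise t \<omega>))\<^sup>2" for t \<omega>
  have step: "(norm (f' (xbar t \<omega>)))\<^sup>2 \<le> 2 / \<eta> * (fed_obj F K (xbar t \<omega>) - fed_obj F K (xbar (Suc t) \<omega>)) + R t \<omega>"
    if "t \<noteq> 0" for t \<omega>
  proof -
    have 1: "2 / \<eta> * (\<eta> / 2 * v) = v" for v using eta_pos by simp
    have 2: "2 / \<eta> * (D + (\<eta> / 2 * L\<^sup>2 * c + p + L * \<eta>\<^sup>2 / 2 * m)) = 2 / \<eta> * D + (L\<^sup>2 * c + 2 / \<eta> * p + L * \<eta> * m)"
      for D c p m using eta_pos by (simp add: field_simps power2_eq_square)
    show ?thesis
      using mult_left_mono[OF descent_step[OF that, of \<omega>], of "2 / \<eta>"] eta_pos unfolding R_def 1 2 by simp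
  qed
  have pw: "(\<Sum>t\<in>{1..T}. (norm (f' (xbar t \<omega>)))\<^sup>2) \<le> 2 / \<eta> * gap + (\<Sum>t\<in>{1..T}. R t \<omega>)" for \<omega>
  proof -
    have "(\<Sum>t\<in>{1..T}. (norm (f' (xbar t \<omega>)))\<^sup>2)
        \<le> (\<Sum>t\<in>{1..T}. 2 / \<eta> * (fed_obj F K (xbar t \<omega>) - fed_obj F K (xbar (Suc t) \<omega>)) + R t \<omega>)"
      by (intro sum_mono step) auto
    also have "\<dots> = 2 / \<eta> * (\<Sum>t\<in>{1..T}. fed_obj F K (xbar t \<omega>) - fed_obj F K (xbar (Suc t) \<omega>)) + (\<Sum>t\<in>{1..T}. R t \<omega>)"
      by (simp add: sum.distrib sum_distrib_left)
    also have "(\<Sum>t\<in>{1..T}. fed_obj F K (xbar t \<omega>) - fed_obj F K (xbar (Suc t) \<omega>))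
        = fed_obj F K x1 - fed_obj F K (xbar (Suc T) \<omega>)"
      by (induction T) (simp_all add: xbar_1)
    also have "2 / \<eta> * (fed_obj F K x1 - fed_obj F K (xbar (Suc T) \<omega>)) \<le> 2 / \<eta> * gap"
      using fstar_le eta_pos by (intro mult_left_mono) auto
    finally show ?thesis by simp
  qed
  have Rint: "integrable M (R t)" for t
    unfolding R_def[abs_def]
    by (intro Bochner_Integration.integrable_add Bochner_Integration.integrable_mult_right consensus_integrable
         sq_integrable_inner probe_sq_integrable mean_noise_sq_integrable sq_integrable_norm_sq)
  have Rexp: "expectation (R t) \<le> ?A + ?B" if "t \<noteq> 0" for t
  proof -
    have "expectation (R t) = L\<^sup>2 * expectation (consensus t)
        + 2 / \<eta> * expectation (\<lambda>\<omega>. probe t \<omega> \<bullet> mean_noise t \<omega>)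
        + L * \<eta> * expectation (\<lambda>\<omega>. (norm (mean_noise t \<omega>))\<^sup>2)"
      unfolding R_def
      using consensus_integrable[of t] sq_integrable_inner[OF probe_sq_integrable[of t] mean_noise_sq_integrable[of t]]
        sq_integrable_norm_sq[OF mean_noise_sq_integrable[of t]]
      by (simp add: Bochner_Integration.integral_add)
    also have "\<dots> \<le> L\<^sup>2 * (6 * \<eta>\<^sup>2 * (real I)\<^sup>2 * (\<sigma>\<^sup>2 + \<zeta>\<^sup>2)) + 2 / \<eta> * 0 + L * \<eta> * (\<sigma>\<^sup>2 / (real b * real K))"
      unfolding mean_noise_orthogonal[OF probe_determined probe_sq_integrable]
      using L_pos eta_pos
      by (intro add_mono mult_left_mono expectation_consensus_le'[OF that] mean_noise_variance order_refl) auto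
    finally show ?thesis by (simp add: mult.assoc mult.left_commute)
  qed
  have int: "integrable M (\<lambda>\<omega>. 2 / \<eta> * gap + (\<Sum>t\<in>{1..T}. R t \<omega>))"
    by (intro Bochner_Integration.integrable_add Bochner_Integration.integrable_sum Rint) simp
  \<comment> \<open>The bound dominates a sum of squares, hence its nonnegative integral is its
    expectation.\<close>
  have nonneg: "0 \<le> 2 / \<eta> * gap + (\<Sum>t\<in>{1..T}. R t \<omega>)" for \<omega>
    by (rule order_trans[OF sum_nonneg pw]) simp
  have "(\<integral>\<^sup>+ \<omega>. ennreal (\<Sum>t\<in>{1..T}. (norm (f' (xbar t \<omega>)))\<^sup>2) \<partial>M)
      \<le> (\<integral>\<^sup>+ \<omega>. ennreal (2 / \<eta> * gap + (\<Sum>t\<in>{1..T}. R t \<omega>)) \<partial>M)"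
    using pw by (intro nn_integral_mono ennreal_leI) auto
  also have "\<dots> = ennreal (expectation (\<lambda>\<omega>. 2 / \<eta> * gap + (\<Sum>t\<in>{1..T}. R t \<omega>)))"
    by (rule nn_integral_eq_integral[OF int]) (rule AE_I2, rule nonneg)
  also have "expectation (\<lambda>\<omega>. 2 / \<eta> * gap + (\<Sum>t\<in>{1..T}. R t \<omega>)) = 2 / \<eta> * gap + (\<Sum>t\<in>{1..T}. expectation (R t))"
    using Rint by (subst Bochner_Integration.integral_add) (auto simp: prob_space intro!: Bochner_Integration.integral_sum)
  also have "ennreal \<dots> \<le> ennreal (2 / \<eta> * gap + real T * (?A + ?B))"
  proof (rule ennreal_leI)
    have "(\<Sum>t\<in>{1..T}. expectation (R t)) \<le> (\<Sum>t\<in>{1..T}. ?A + ?B)"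
      by (intro sum_mono Rexp) auto
    then show "2 / \<eta> * gap + (\<Sum>t\<in>{1..T}. expectation (R t)) \<le> 2 / \<eta> * gap + real T * (?A + ?B)"
      by simp
  qed
  finally show ?thesis .
qed

lemma fedavg_error_le:
  assumes "1 \<le> T"
  shows "fedavg_error M g G \<eta> I b K x1 \<xi> T
     \<le> ennreal (2 * gap / (\<eta> * real T) + 6 * L\<^sup>2 * \<eta>\<^sup>2 * (real I)\<^sup>2 * (\<sigma>\<^sup>2 + \<zeta>\<^sup>2) + L * \<eta> * \<sigma>\<^sup>2 / (real b * real K))"
proof -
  let ?B = "2 / \<eta> * gap + real T * (6 * L\<^sup>2 * \<eta>\<^sup>2 * (real I)\<^sup>2 * (\<sigma>\<^sup>2 + \<zeta>\<^sup>2) + L * \<eta> * \<sigma>\<^sup>2 / (real b * real K))"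
  have [measurable]: "(\<lambda>\<omega>. (norm (f' (xbar t \<omega>)))\<^sup>2) \<in> borel_measurable M" for t
    using sq_integrable_norm_sq[OF grad_sq_integrable] by (rule borel_measurable_integrable)
  have "(\<Sum>t\<in>{1..T}. \<integral>\<^sup>+ \<omega>. ennreal ((norm (f' (xbar t \<omega>)))\<^sup>2) \<partial>M)
      = (\<integral>\<^sup>+ \<omega>. ennreal (\<Sum>t\<in>{1..T}. (norm (f' (xbar t \<omega>)))\<^sup>2) \<partial>M)"
    by (subst nn_integral_sum[symmetric]) auto
  also have "\<dots> \<le> ennreal ?B" by (rule gradient_sum_le)
  finally have "fedavg_error M g G \<eta> I b K x1 \<xi> T \<le> ennreal ?B / ennreal (real T)"
    unfolding fedavg_error_def xbar_def by (rule divide_right_mono_ennreal)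
  \<comment> \<open>The quotient moves inside \<open>ennreal\<close> because the numerator is
    nonnegative; for the gap this is \<open>fstar_le\<close>.\<close>
  also have "\<dots> = ennreal (?B / real T)"
    using assms eta_pos L_pos fstar_le[of x1] by (intro divide_ennreal) auto
  also have "?B / real T = 2 * gap / (\<eta> * real T) + 6 * L\<^sup>2 * \<eta>\<^sup>2 * (real I)\<^sup>2 * (\<sigma>\<^sup>2 + \<zeta>\<^sup>2) + L * \<eta> * \<sigma>\<^sup>2 / (real b * real K)"
    using assms eta_pos by (simp add: add_divide_distrib)
  finally show ?thesis .
qed

end

section \<open>Rates and parameters\<close>

text \<open>Written as exponentials, the power identities below become linear identities in
  \<open>ln t\<close> and \<open>ln k\<close>.\<close>

lemma powr_ratio_cube:
  assumes "0 < (k::real)" "0 < t"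
  shows "(t / k ^ 3) powr a = exp (a * ln t - 3 * a * ln k)"
proof -
  have "ln (t / k ^ 3) = ln t - 3 * ln k"
    using assms by (simp add: ln_div ln_realpow)
  then show ?thesis using assms by (simp add: powr_def right_diff_distrib mult.left_commute)
qed

text \<open>The power of \<open>t / k ^ 3\<close> is the order of \<open>b\<close>, so the squared
  rate is the order of the total sample count \<open>T b K\<close>.\<close>

lemma rate_square:
  assumes "0 < (k::real)" "0 < t"
  shows "(k powr (\<nu> / 2) * t powr (2 / 3 - \<nu> / 6))\<^sup>2 = (t / k ^ 3) powr ((1 - \<nu>) / 3) * k * t"
proof -
  have "(t / k ^ 3) powr ((1 - \<nu>) / 3) * k * t = exp ((1 - \<nu>) / 3 * ln t - 3 * ((1 - \<nu>) / 3) * ln k) * exp (ln k) * exp (ln t)"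
    using assms by (simp add: powr_ratio_cube)
  also have "\<dots> = exp (2 * (\<nu> / 2 * ln k + (2 / 3 - \<nu> / 6) * ln t))"
    unfolding exp_add[symmetric] by (rule arg_cong[of _ _ exp]) (simp add: field_simps)
  also have "\<dots> = (k powr (\<nu> / 2) * t powr (2 / 3 - \<nu> / 6))\<^sup>2"
    unfolding exp_double exp_add using assms by (simp add: powr_def)
  finally show ?thesis by simp
qed

text \<open>The power of \<open>t / k ^ 3\<close> is the order of \<open>b I^2\<close>, so the drift
  term \<open>\<eta>^2 I^2 = b K I^2 / T\<close> is of the order of the inverse rate.\<close>

lemma rate_times_drift:
  assumes "0 < (k::real)" "0 < t"
  shows "(k powr (\<nu> / 2) * t powr (2 / 3 - \<nu> / 6)) * ((t / k ^ 3) powr (1 / 3 + \<nu> / 6) * k) = t"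
proof -
  have "(k powr (\<nu> / 2) * t powr (2 / 3 - \<nu> / 6)) * ((t / k ^ 3) powr (1 / 3 + \<nu> / 6) * k)
     = (exp (\<nu> / 2 * ln k) * exp ((2 / 3 - \<nu> / 6) * ln t)) * (exp ((1 / 3 + \<nu> / 6) * ln t - 3 * (1 / 3 + \<nu> / 6) * ln k) * exp (ln k))"
    using assms unfolding powr_ratio_cube[OF assms] by (simp add: powr_def)
  also have "\<dots> = exp (ln t)"
    unfolding exp_add[symmetric] by (rule arg_cong[of _ _ exp]) (simp add: field_simps)
  finally show ?thesis using assms by simp
qed

text \<open>The power of \<open>t / k ^ 3\<close> is the order of \<open>I\<close>, so the number of
  rounds \<open>T / I\<close> is of the order of the rate to the power \<open>3 / 2\<close>.\<close>

lemma rate_powr_three_halves: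
  assumes "0 < (k::real)" "0 < t"
  shows "(k powr (\<nu> / 2) * t powr (2 / 3 - \<nu> / 6)) powr (3 / 2) * (t / k ^ 3) powr (\<nu> / 4) = t"
proof -
  have "(k powr (\<nu> / 2) * t powr (2 / 3 - \<nu> / 6)) powr (3 / 2) * (t / k ^ 3) powr (\<nu> / 4)
     = (exp (\<nu> / 2 * (3 / 2) * ln k) * exp ((2 / 3 - \<nu> / 6) * (3 / 2) * ln t)) * exp (\<nu> / 4 * ln t - 3 * (\<nu> / 4) * ln k)"
    unfolding powr_ratio_cube[OF assms] using assms by (subst powr_mult) (simp_all add: powr_powr, simp_all add: powr_def)
  also have "\<dots> = exp (ln t)"
    unfolding exp_add[symmetric] by (rule arg_cong[of _ _ exp]) (simp add: field_simps)
  finally show ?thesis using assms by simp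
qed

text \<open>The initial gap contributes \<open>2 * sqrt c\<close>, the averaged noise
  \<open>L * sqrt c\<close>, and the drift \<open>6 L^2 c^3\<close>.\<close>

definition rate_const :: "real \<Rightarrow> real \<Rightarrow> real" where
  "rate_const c L = (2 + L) * sqrt c + 6 * L\<^sup>2 * c ^ 3"

lemma fedavg_rate:
  fixes F :: "nat \<Rightarrow> 'd::euclidean_space \<Rightarrow> real"
  assumes asm: "fed_assumptions S D K F G g L \<sigma> \<zeta>" and smp: "fed_samples M S D K b \<xi>"
    and params: "fedavg_params \<nu> c L K T I b" and c: "1 \<le> c" and L: "0 < L"
  shows "fedavg_error M g G (fedavg_stepsize K T b) I b K x1 \<xi> T
      \<le> ennreal (rate_const c L * ((fed_obj F K x1 - fed_fstar F K) + \<sigma>\<^sup>2 + \<zeta>\<^sup>2)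
           / (real K powr (\<nu> / 2) * real T powr (2 / 3 - \<nu> / 6)))"
proof -
  let ?u = "real T / real K ^ 3" and ?\<eta> = "fedavg_stepsize K T b"
  define y where "y = real K powr (\<nu> / 2) * real T powr (2 / 3 - \<nu> / 6)"
  \<comment> \<open>Both \<open>\<eta> T\<close> and \<open>b K / \<eta>\<close> equal
    \<open>w\<close>, so the gap term and the noise term have the common factor
    \<open>1 / w\<close>.\<close>
  define w where "w = sqrt (real b * real K * real T)"
  have pos: "0 < real K" "0 < real T" "1 \<le> I" "0 < real b" "1 \<le> K" "1 \<le> T" "1 \<le> b"
    and I_le: "real I \<le> c * ?u powr (\<nu> / 4)"
    and b_ge: "?u powr ((1 - \<nu>) / 3) \<le> c * real b"
    and b_le: "real b \<le> c * ?u powr ((1 - \<nu>) / 3)"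
    and small: "81 * L\<^sup>2 * (real I)\<^sup>2 * real b * real K \<le> real T"
    using params unfolding fedavg_params_def by auto
  have y: "0 < y" and w: "0 < w" using pos by (auto simp: y_def w_def)
  have w2: "w\<^sup>2 = real b * real K * real T" using pos by (simp add: w_def)
  have eta2: "?\<eta>\<^sup>2 = real b * real K / real T" using pos by (simp add: fedavg_stepsize_def)
  have eta_pos: "0 < ?\<eta>" using pos by (simp add: fedavg_stepsize_def)
  have "(?\<eta> * real T)\<^sup>2 = w\<^sup>2"
    unfolding power_mult_distrib eta2 w2 using pos by (simp add: power2_eq_square)
  then have etaT: "?\<eta> * real T = w" using eta_pos pos w by (simp add: power2_eq_iff_nonneg)
  have etab: "?\<eta> / (real b * real K) = 1 / w"
  proof -
    have "(w * ?\<eta>) * real T = (real b * real K) * real T"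
      using w2 etaT by (simp add: power2_eq_square mult.assoc)
    then have "w * ?\<eta> = real b * real K" using pos by simp
    then show ?thesis using w pos by (simp add: field_simps)
  qed
  have step: "81 * L\<^sup>2 * (real I)\<^sup>2 * ?\<eta>\<^sup>2 \<le> 1"
    unfolding eta2 using small pos by (simp add: mult.assoc)
  interpret prob_space M using smp unfolding fed_samples_def by blast
  interpret fedavg_run M S D K F G g L \<sigma> \<zeta> "?\<eta>" I b x1 \<xi>
    by unfold_locales (use asm smp pos L eta_pos step in auto)
  have gap: "fed_fstar F K \<le> fed_obj F K x1" by (rule fstar_le)
  \<comment> \<open>The lower bound on the batch size enters here: the batch must be large enough
    for \<open>1 / w\<close> to reach the rate.\<close>
  have "y\<^sup>2 \<le> (sqrt c * w)\<^sup>2"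
  proof -
    have "y\<^sup>2 = ?u powr ((1 - \<nu>) / 3) * real K * real T"
      unfolding y_def by (rule rate_square) (use pos in auto)
    also have "\<dots> \<le> (c * real b) * real K * real T"
      using b_ge by (intro mult_right_mono) auto
    finally show ?thesis using c by (simp add: power_mult_distrib w2)
  qed
  then have "y \<le> sqrt c * w" by (rule power2_le_imp_le) (use w c in simp)
  then have inv_w: "1 / w \<le> sqrt c / y" using y w by (simp add: field_simps)
  \<comment> \<open>The upper bounds enter here: one factor \<open>c\<close> from \<open>b\<close>
    and two from \<open>I^2\<close> give \<open>c ^ 3\<close>.\<close>
  have drift: "?\<eta>\<^sup>2 * (real I)\<^sup>2 \<le> c ^ 3 / y"
  proof -
    have "(real I)\<^sup>2 \<le> (c * ?u powr (\<nu> / 4))\<^sup>2" by (rule power_mono[OF I_le]) simp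
    also have "\<dots> = c\<^sup>2 * ?u powr (\<nu> / 2)"
      by (simp add: power_mult_distrib power2_eq_square flip: powr_add)
    finally have "real b * (real I)\<^sup>2 \<le> (c * ?u powr ((1 - \<nu>) / 3)) * (c\<^sup>2 * ?u powr (\<nu> / 2))"
      using b_le c by (intro mult_mono) auto
    also have "\<dots> = c ^ 3 * (?u powr ((1 - \<nu>) / 3) * ?u powr (\<nu> / 2))"
      by (simp add: power2_eq_square power3_eq_cube)
    also have "?u powr ((1 - \<nu>) / 3) * ?u powr (\<nu> / 2) = ?u powr (1 / 3 + \<nu> / 6)"
      unfolding powr_add[symmetric] by (rule arg_cong[where f = "(powr) ?u"]) (simp add: field_simps)
    finally have "y * (real b * (real I)\<^sup>2 * real K) \<le> y * (c ^ 3 * ?u powr (1 / 3 + \<nu> / 6) * real K)"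
      using y by (intro mult_left_mono mult_right_mono) auto
    also have "\<dots> = c ^ 3 * (y * (?u powr (1 / 3 + \<nu> / 6) * real K))" by simp
    also have "y * (?u powr (1 / 3 + \<nu> / 6) * real K) = real T"
      unfolding y_def by (rule rate_times_drift) (use pos in auto)
    finally show ?thesis unfolding eta2 using y pos by (simp add: field_simps)
  qed
  let ?E = "gap + \<sigma>\<^sup>2 + \<zeta>\<^sup>2"
  have E: "gap \<le> ?E" "\<sigma>\<^sup>2 + \<zeta>\<^sup>2 \<le> ?E" "\<sigma>\<^sup>2 \<le> ?E"
    using gap zero_le_power2[of \<sigma>] zero_le_power2[of \<zeta>] by linarith+
  have third: "L * ?\<eta> * \<sigma>\<^sup>2 / (real b * real K) = L * \<sigma>\<^sup>2 * (1 / w)"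
    unfolding etab[symmetric] by simp
  have "2 * gap / (?\<eta> * real T) + 6 * L\<^sup>2 * ?\<eta>\<^sup>2 * (real I)\<^sup>2 * (\<sigma>\<^sup>2 + \<zeta>\<^sup>2) + L * ?\<eta> * \<sigma>\<^sup>2 / (real b * real K)
      = 2 * gap * (1 / w) + 6 * L\<^sup>2 * (\<sigma>\<^sup>2 + \<zeta>\<^sup>2) * (?\<eta>\<^sup>2 * (real I)\<^sup>2) + L * \<sigma>\<^sup>2 * (1 / w)"
    unfolding etaT third by simp
  also have "\<dots> \<le> 2 * gap * (sqrt c / y) + 6 * L\<^sup>2 * (\<sigma>\<^sup>2 + \<zeta>\<^sup>2) * (c ^ 3 / y) + L * \<sigma>\<^sup>2 * (sqrt c / y)"
    using inv_w drift gap L by (intro add_mono mult_left_mono) auto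
  also have "\<dots> \<le> 2 * ?E * (sqrt c / y) + 6 * L\<^sup>2 * ?E * (c ^ 3 / y) + L * ?E * (sqrt c / y)"
    using L c y by (intro add_mono mult_right_mono mult_left_mono E) auto
  also have "\<dots> = rate_const c L * ?E / y"
  proof -
    have "2 * e * (sqrt c / y) + 6 * L\<^sup>2 * e * (c ^ 3 / y) + L * e * (sqrt c / y) = rate_const c L * e / y" for e
      unfolding rate_const_def using y by (simp add: field_simps)
    then show ?thesis .
  qed
  finally have "2 * gap / (?\<eta> * real T) + 6 * L\<^sup>2 * ?\<eta>\<^sup>2 * (real I)\<^sup>2 * (\<sigma>\<^sup>2 + \<zeta>\<^sup>2) + L * ?\<eta> * \<sigma>\<^sup>2 / (real b * real K)
      \<le> rate_const c L * ?E / y" .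
  from order_trans[OF fedavg_error_le[OF pos(6)] ennreal_leI[OF this]]
  show "fedavg_error M g G ?\<eta> I b K x1 \<xi> T \<le> ennreal (rate_const c L * ?E
           / (real K powr (\<nu> / 2) * real T powr (2 / 3 - \<nu> / 6)))"
    unfolding y_def .
qed

section \<open>Integer parameters for a prescribed accuracy\<close>

lemma nat_floor_bounds:
  fixes z :: real
  assumes "1 \<le> z"
  shows "1 \<le> nat \<lfloor>z\<rfloor>" "real (nat \<lfloor>z\<rfloor>) \<le> z" "z \<le> 2 * real (nat \<lfloor>z\<rfloor>)"
proof -
  have "1 \<le> \<lfloor>z\<rfloor>" using assms by simp
  moreover have "real (nat \<lfloor>z\<rfloor>) = of_int \<lfloor>z\<rfloor>" using assms by simp
  moreover have "z < of_int \<lfloor>z\<rfloor> + 1" by simp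
  ultimately show "1 \<le> nat \<lfloor>z\<rfloor>" "real (nat \<lfloor>z\<rfloor>) \<le> z" "z \<le> 2 * real (nat \<lfloor>z\<rfloor>)"
    by linarith+
qed

text \<open>\<open>T\<close> is chosen to place the rate between \<open>A / \<epsilon>\<close> and
  \<open>2 A / \<epsilon>\<close>. The lower end gives the accuracy, the upper end both costs by the
  power identities.\<close>

lemma fedavg_parameter_choice:
  assumes nu: "0 \<le> \<nu>" "\<nu> \<le> 1" and L: "0 < L" and A: "0 < A" and K: "1 \<le> K"
  obtains \<epsilon>0 where "0 < \<epsilon>0"
    "\<And>\<epsilon>. 0 < \<epsilon> \<Longrightarrow> \<epsilon> < \<epsilon>0 \<Longrightarrow> \<exists>T I b. fedavg_params \<nu> 2 L K T I b \<and>
       A / (real K powr (\<nu> / 2) * real T powr (2 / 3 - \<nu> / 6)) \<le> \<epsilon> \<and>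
       real T * real b * real K \<le> (2 * A)\<^sup>2 / \<epsilon>\<^sup>2 \<and>
       real T / real I \<le> 2 * (2 * A) powr (3 / 2) / \<epsilon> powr (3 / 2)"
proof -
  define p where "p = 2 / 3 - \<nu> / 6"
  have p: "1 / 2 \<le> p" "p \<le> 1" using nu by (auto simp: p_def)
  \<comment> \<open>If \<open>T / K ^ 3\<close> is at least \<open>B\<close>, then its square root
    is at least \<open>81 L^2\<close>, as the step size condition requires; the 1 makes all powers
    with nonnegative exponent at least 1.\<close>
  define B where "B = max 1 ((81 * L\<^sup>2)\<^sup>2)"
  define R where "R = real K ^ 3 * B"
  define k where "k = real K powr (\<nu> / 2)"
  have k: "0 < k" and K': "0 < real K" using K by (auto simp: k_def)
  have K3: "1 \<le> real K ^ 3" using K by (intro one_le_power) simp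
  have B1: "1 \<le> B" by (simp add: B_def)
  have R1: "1 \<le> R" using mult_mono[OF K3 B1] K3 by (simp add: R_def)
  \<comment> \<open>Being below this threshold is the same as \<open>\<tau> > R\<close>, which makes
    \<open>T / K ^ 3\<close> at least \<open>B\<close>.\<close>
  show thesis
  proof (rule that[of "A / (k * R powr p)"])
    show "0 < A / (k * R powr p)" using A k R1 by simp
  next
    fix \<epsilon> :: real assume e: "0 < \<epsilon>" "\<epsilon> < A / (k * R powr p)"
    \<comment> \<open>The real solution of \<open>k * \<tau> powr p = A / \<epsilon>\<close>, that
      is, of rate equal to \<open>A / \<epsilon>\<close>. Rounding up at most doubles it, and the
      rate also at most doubles because \<open>p \<le> 1\<close>.\<close>
    define \<tau> where "\<tau> = (A / (\<epsilon> * k)) powr (1 / p)"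
    have \<tau>p: "\<tau> powr p = A / (\<epsilon> * k)" using A e k p by (simp add: \<tau>_def powr_powr)
    have "R powr p < \<tau> powr p"
      unfolding \<tau>p using e k R1 by (simp add: field_simps)
    then have R\<tau>: "R < \<tau>"
      using powr_mono2[of p \<tau> R] p by (force simp: \<tau>_def not_less[symmetric])
    define T where "T = nat \<lceil>\<tau>\<rceil>"
    have T: "\<tau> \<le> real T" "real T \<le> 2 * \<tau>" "1 \<le> T" "0 < real T"
      using R\<tau> R1 unfolding T_def by linarith+
    define u where "u = real T / real K ^ 3"
    have "real K ^ 3 * B \<le> real T" using R\<tau> T unfolding R_def by linarith
    then have uB: "B \<le> u" unfolding u_def using K' by (simp add: field_simps)
    then have u1: "1 \<le> u" using B1 by linarith
    \<comment> \<open>Rounding down a number that is at least 1 loses at most a factor 2; hence the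
      constant 2 in \<open>fedavg_params\<close>.\<close>
    define I where "I = nat \<lfloor>u powr (\<nu> / 4)\<rfloor>"
    define b where "b = nat \<lfloor>u powr ((1 - \<nu>) / 3)\<rfloor>"
    have I: "1 \<le> I" "real I \<le> u powr (\<nu> / 4)" "u powr (\<nu> / 4) \<le> 2 * real I"
      unfolding I_def using nu by (intro nat_floor_bounds ge_one_powr_ge_zero u1; simp)+
    have b: "1 \<le> b" "real b \<le> u powr ((1 - \<nu>) / 3)" "u powr ((1 - \<nu>) / 3) \<le> 2 * real b"
      unfolding b_def using nu by (intro nat_floor_bounds ge_one_powr_ge_zero u1; simp)+
    define y where "y = k * real T powr p"
    have y: "0 < y" using k T by (simp add: y_def)
    have y_ge: "A / \<epsilon> \<le> y"
    proof -
      have "A / \<epsilon> = k * \<tau> powr p" using \<tau>p k by (simp add: field_simps)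
      also have "\<dots> \<le> y" unfolding y_def
        using k T p R\<tau> R1 by (intro mult_left_mono powr_mono2) auto
      finally show ?thesis .
    qed
    have y_le: "y \<le> 2 * A / \<epsilon>"
    proof -
      have "real T powr p \<le> (2 * \<tau>) powr p"
        using T p by (intro powr_mono2) auto
      also have "\<dots> = 2 powr p * \<tau> powr p" using R\<tau> R1 by (simp add: powr_mult)
      also have "\<dots> \<le> 2 powr 1 * \<tau> powr p" using p by (intro mult_right_mono powr_mono) auto
      finally have "y \<le> k * (2 * \<tau> powr p)" unfolding y_def using k by (intro mult_left_mono) auto
      also have "\<dots> = 2 * A / \<epsilon>" using \<tau>p k by (simp add: field_simps)
      finally show ?thesis .
    qed
    \<comment> \<open>With \<open>u = T / K ^ 3\<close>, the product \<open>I^2 b\<close> is at most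
      \<open>u powr (1 / 3 + \<nu> / 6)\<close>, hence at most \<open>u powr (1 / 2)\<close> since
      \<open>\<nu> \<le> 1\<close>. The other half power covers \<open>81 L^2\<close>, and
      \<open>K \<le> K ^ 3\<close> completes \<open>u * K ^ 3 = T\<close>.\<close>
    have sm: "81 * L\<^sup>2 * (real I)\<^sup>2 * real b * real K \<le> real T"
    proof -
      have "(81 * L\<^sup>2)\<^sup>2 \<le> (u powr (1 / 2))\<^sup>2"
        using uB u1 unfolding B_def by (simp add: powr_half_sqrt)
      then have L2: "81 * L\<^sup>2 \<le> u powr (1 / 2)" by (rule power2_le_imp_le) simp
      have "(real I)\<^sup>2 \<le> (u powr (\<nu> / 4))\<^sup>2" by (rule power_mono[OF I(2)]) simp
      also have "\<dots> = u powr (\<nu> / 2)" by (simp add: power2_eq_square flip: powr_add)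
      finally have "(real I)\<^sup>2 * real b \<le> u powr (\<nu> / 2) * u powr ((1 - \<nu>) / 3)"
        using b by (intro mult_mono) auto
      also have "\<dots> = u powr (1 / 3 + \<nu> / 6)"
        unfolding powr_add[symmetric] by (rule arg_cong[where f = "(powr) u"]) (simp add: field_simps)
      also have "\<dots> \<le> u powr (1 / 2)" using nu u1 by (intro powr_mono) auto
      finally have "(81 * L\<^sup>2) * ((real I)\<^sup>2 * real b) \<le> u powr (1 / 2) * u powr (1 / 2)"
        using L2 by (intro mult_mono) auto
      also have "\<dots> = u" using u1 by (simp flip: powr_add)
      finally have "(81 * L\<^sup>2) * ((real I)\<^sup>2 * real b) * real K \<le> u * real K ^ 3"
        using K u1 self_le_power[of "real K" 3] by (intro mult_mono) auto
      also have "\<dots> = real T" unfolding u_def using K' by simp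
      finally show ?thesis by (simp add: mult.assoc)
    qed
    have params: "fedavg_params \<nu> 2 L K T I b"
      unfolding fedavg_params_def u_def[symmetric] using K T I b sm by (auto intro: order_trans)
    have "real T * real b * real K = real b * real K * real T" by simp
    also have "\<dots> \<le> u powr ((1 - \<nu>) / 3) * real K * real T"
      using b by (intro mult_right_mono) auto
    also have "\<dots> = y\<^sup>2" unfolding y_def k_def p_def u_def by (rule rate_square[symmetric, OF K' T(4)])
    also have "\<dots> \<le> (2 * A / \<epsilon>)\<^sup>2" using y y_le by (intro power_mono) auto
    finally have samples: "real T * real b * real K \<le> (2 * A)\<^sup>2 / \<epsilon>\<^sup>2" by (simp add: power_divide)
    have "real T / real I = y powr (3 / 2) * (u powr (\<nu> / 4) / real I)"
      using rate_powr_three_halves[OF K' T(4), of \<nu>] unfolding y_def k_def p_def u_def by simp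
    also have "\<dots> \<le> (2 * A / \<epsilon>) powr (3 / 2) * 2"
      using I y y_le by (intro mult_mono powr_mono2) (auto simp: field_simps)
    finally have rounds: "real T / real I \<le> 2 * (2 * A) powr (3 / 2) / \<epsilon> powr (3 / 2)"
      using A e by (simp add: powr_divide mult.commute)
    have "A / y \<le> \<epsilon>" using y_ge y e by (simp add: field_simps)
    then show "\<exists>T I b. fedavg_params \<nu> 2 L K T I b \<and>
       A / (real K powr (\<nu> / 2) * real T powr (2 / 3 - \<nu> / 6)) \<le> \<epsilon> \<and>
       real T * real b * real K \<le> (2 * A)\<^sup>2 / \<epsilon>\<^sup>2 \<and>
       real T / real I \<le> 2 * (2 * A) powr (3 / 2) / \<epsilon> powr (3 / 2)"
      using params samples rounds unfolding y_def k_def p_def by blast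
  qed
qed

section \<open>Convergence rate and complexities\<close>

theorem theorem2:
  shows
  \<comment> \<open>(i) convergence rate\<close>
  "(\<forall>\<nu> c L. 0 \<le> \<nu> \<and> \<nu> \<le> 1 \<and> 1 \<le> c \<and> 0 < L \<longrightarrow>
     (\<exists>C. \<forall>(S :: 'a measure) D K (F :: nat \<Rightarrow> 'd::euclidean_space \<Rightarrow> real) G g \<sigma> \<zeta> x1 T I b
            (M :: 'm measure) \<xi>.
        fed_assumptions S D K F G g L \<sigma> \<zeta> \<and> fed_samples M S D K b \<xi> \<and>
        fedavg_params \<nu> c L K T I b \<longrightarrow>
        fedavg_error M g G (fedavg_stepsize K T b) I b K x1 \<xi> T
          \<le> ennreal (C * ((fed_obj F K x1 - fed_fstar F K) + \<sigma>\<^sup>2 + \<zeta>\<^sup>2)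
                     / (real K powr (\<nu> / 2) * real T powr (2 / 3 - \<nu> / 6)))))
   \<and>
  \<comment> \<open>(ii) sample complexity O(eps^-2) and communication complexity O(eps^-3/2)\<close>
   (\<forall>\<nu> L \<Delta> \<sigma> \<zeta>. 0 \<le> \<nu> \<and> \<nu> \<le> 1 \<and> 0 < L \<and> 0 \<le> \<Delta> \<and> 0 \<le> \<sigma> \<and> 0 \<le> \<zeta> \<longrightarrow>
     (\<exists>C c. 1 \<le> c \<and> (\<forall>K. 1 \<le> K \<longrightarrow> (\<exists>\<epsilon>0 > 0. \<forall>\<epsilon>. 0 < \<epsilon> \<and> \<epsilon> < \<epsilon>0 \<longrightarrow>
        (\<exists>T I b. fedavg_params \<nu> c L K T I b \<and>
           real T * real b * real K \<le> C / \<epsilon>\<^sup>2 \<and>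
           real T / real I \<le> C / \<epsilon> powr (3 / 2) \<and>
           (\<forall>(S :: 'a measure) D (F :: nat \<Rightarrow> 'd \<Rightarrow> real) G g x1 (M :: 'm measure) \<xi>.
              fed_assumptions S D K F G g L \<sigma> \<zeta> \<and> fed_obj F K x1 - fed_fstar F K \<le> \<Delta> \<and>
              fed_samples M S D K b \<xi> \<longrightarrow>
              fedavg_error M g G (fedavg_stepsize K T b) I b K x1 \<xi> T \<le> ennreal \<epsilon>))))))"
proof (intro conjI allI impI)
  fix \<nu> c L :: real
  assume "0 \<le> \<nu> \<and> \<nu> \<le> 1 \<and> 1 \<le> c \<and> 0 < L"
  then show "\<exists>C. \<forall>(S :: 'a measure) D K (F :: nat \<Rightarrow> 'd \<Rightarrow> real) G g \<sigma> \<zeta> x1 T I b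
            (M :: 'm measure) \<xi>.
        fed_assumptions S D K F G g L \<sigma> \<zeta> \<and> fed_samples M S D K b \<xi> \<and>
        fedavg_params \<nu> c L K T I b \<longrightarrow>
        fedavg_error M g G (fedavg_stepsize K T b) I b K x1 \<xi> T
          \<le> ennreal (C * ((fed_obj F K x1 - fed_fstar F K) + \<sigma>\<^sup>2 + \<zeta>\<^sup>2)
                     / (real K powr (\<nu> / 2) * real T powr (2 / 3 - \<nu> / 6)))"
    by (intro exI[of _ "rate_const c L"] allI impI) (elim conjE, rule fedavg_rate)
next
  fix \<nu> L \<Delta> \<sigma> \<zeta> :: real
  assume *: "0 \<le> \<nu> \<and> \<nu> \<le> 1 \<and> 0 < L \<and> 0 \<le> \<Delta> \<and> 0 \<le> \<sigma> \<and> 0 \<le> \<zeta>"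
  \<comment> \<open>The numerator of the rate with the gap replaced by its bound \<Delta>; the 1
    keeps it positive when \<Delta>, \<sigma> and \<zeta> all vanish.\<close>
  define A where "A = rate_const 2 L * (\<Delta> + \<sigma>\<^sup>2 + \<zeta>\<^sup>2) + 1"
  \<comment> \<open>The sum of both cost constants serves both complexities. It does not depend on
    \<open>K\<close>, so dividing the sample bound by \<open>K\<close> gives the count per worker;
    only the threshold \<open>\<epsilon>0\<close> varies with \<open>K\<close>.\<close>
  define C where "C = (2 * A)\<^sup>2 + 2 * (2 * A) powr (3 / 2)"
  have rc: "0 \<le> rate_const 2 L" using * by (simp add: rate_const_def)
  then have A: "0 < A" using * by (auto simp: A_def intro!: add_nonneg_pos)
  show "\<exists>C c. 1 \<le> c \<and> (\<forall>K. 1 \<le> K \<longrightarrow> (\<exists>\<epsilon>0 > 0. \<forall>\<epsilon>. 0 < \<epsilon> \<and> \<epsilon> < \<epsilon>0 \<longrightarrow>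
        (\<exists>T I b. fedavg_params \<nu> c L K T I b \<and>
           real T * real b * real K \<le> C / \<epsilon>\<^sup>2 \<and>
           real T / real I \<le> C / \<epsilon> powr (3 / 2) \<and>
           (\<forall>(S :: 'a measure) D (F :: nat \<Rightarrow> 'd \<Rightarrow> real) G g x1 (M :: 'm measure) \<xi>.
              fed_assumptions S D K F G g L \<sigma> \<zeta> \<and> fed_obj F K x1 - fed_fstar F K \<le> \<Delta> \<and>
              fed_samples M S D K b \<xi> \<longrightarrow>
              fedavg_error M g G (fedavg_stepsize K T b) I b K x1 \<xi> T \<le> ennreal \<epsilon>))))"
  proof (rule exI[of _ C], rule exI[of _ 2], intro conjI allI impI)
    fix K :: nat assume K: "1 \<le> K"
    obtain \<epsilon>0 where \<epsilon>0: "0 < \<epsilon>0" and choice: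
      "\<And>\<epsilon>. 0 < \<epsilon> \<Longrightarrow> \<epsilon> < \<epsilon>0 \<Longrightarrow> \<exists>T I b. fedavg_params \<nu> 2 L K T I b \<and>
         A / (real K powr (\<nu> / 2) * real T powr (2 / 3 - \<nu> / 6)) \<le> \<epsilon> \<and>
         real T * real b * real K \<le> (2 * A)\<^sup>2 / \<epsilon>\<^sup>2 \<and>
         real T / real I \<le> 2 * (2 * A) powr (3 / 2) / \<epsilon> powr (3 / 2)"
      using fedavg_parameter_choice[of \<nu> L A K] * A K by metis
    show "\<exists>\<epsilon>0 > 0. \<forall>\<epsilon>. 0 < \<epsilon> \<and> \<epsilon> < \<epsilon>0 \<longrightarrow>
        (\<exists>T I b. fedavg_params \<nu> 2 L K T I b \<and>
           real T * real b * real K \<le> C / \<epsilon>\<^sup>2 \<and>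
           real T / real I \<le> C / \<epsilon> powr (3 / 2) \<and>
           (\<forall>(S :: 'a measure) D (F :: nat \<Rightarrow> 'd \<Rightarrow> real) G g x1 (M :: 'm measure) \<xi>.
              fed_assumptions S D K F G g L \<sigma> \<zeta> \<and> fed_obj F K x1 - fed_fstar F K \<le> \<Delta> \<and>
              fed_samples M S D K b \<xi> \<longrightarrow>
              fedavg_error M g G (fedavg_stepsize K T b) I b K x1 \<xi> T \<le> ennreal \<epsilon>))"
    proof (rule exI[of _ \<epsilon>0], intro conjI allI impI \<epsilon>0)
      fix \<epsilon> :: real assume "0 < \<epsilon> \<and> \<epsilon> < \<epsilon>0"
      then obtain T I b where params: "fedavg_params \<nu> 2 L K T I b"
        and err: "A / (real K powr (\<nu> / 2) * real T powr (2 / 3 - \<nu> / 6)) \<le> \<epsilon>"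
        and cost: "real T * real b * real K \<le> (2 * A)\<^sup>2 / \<epsilon>\<^sup>2"
        and rounds: "real T / real I \<le> 2 * (2 * A) powr (3 / 2) / \<epsilon> powr (3 / 2)"
        using choice by blast
      have "(2 * A)\<^sup>2 / \<epsilon>\<^sup>2 \<le> C / \<epsilon>\<^sup>2" "2 * (2 * A) powr (3 / 2) / \<epsilon> powr (3 / 2) \<le> C / \<epsilon> powr (3 / 2)"
        unfolding C_def by (intro divide_right_mono; simp)+
      with cost rounds have "real T * real b * real K \<le> C / \<epsilon>\<^sup>2" "real T / real I \<le> C / \<epsilon> powr (3 / 2)"
        by linarith+
      moreover have "fedavg_error M g G (fedavg_stepsize K T b) I b K x1 \<xi> T \<le> ennreal \<epsilon>"
        if asm: "fed_assumptions S D K F G g L \<sigma> \<zeta>" and gap: "fed_obj F K x1 - fed_fstar F K \<le> \<Delta>"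
          and smp: "fed_samples M S D K b \<xi>"
        for S :: "'a measure" and D and F :: "nat \<Rightarrow> 'd \<Rightarrow> real" and G g x1 and M :: "'m measure" and \<xi>
      proof -
        have "rate_const 2 L * ((fed_obj F K x1 - fed_fstar F K) + \<sigma>\<^sup>2 + \<zeta>\<^sup>2)
            / (real K powr (\<nu> / 2) * real T powr (2 / 3 - \<nu> / 6))
            \<le> A / (real K powr (\<nu> / 2) * real T powr (2 / 3 - \<nu> / 6))"
          unfolding A_def using gap rc
          by (intro divide_right_mono add_increasing2[OF zero_le_one] mult_left_mono) auto
        with err have "rate_const 2 L * ((fed_obj F K x1 - fed_fstar F K) + \<sigma>\<^sup>2 + \<zeta>\<^sup>2)
            / (real K powr (\<nu> / 2) * real T powr (2 / 3 - \<nu> / 6)) \<le> \<epsilon>"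
          by linarith
        from order_trans[OF fedavg_rate[OF asm smp params] ennreal_leI[OF this]] show ?thesis
          using * by simp
      qed
      ultimately show "\<exists>T I b. fedavg_params \<nu> 2 L K T I b \<and>
           real T * real b * real K \<le> C / \<epsilon>\<^sup>2 \<and>
           real T / real I \<le> C / \<epsilon> powr (3 / 2) \<and>
           (\<forall>(S :: 'a measure) D (F :: nat \<Rightarrow> 'd \<Rightarrow> real) G g x1 (M :: 'm measure) \<xi>.
              fed_assumptions S D K F G g L \<sigma> \<zeta> \<and> fed_obj F K x1 - fed_fstar F K \<le> \<Delta> \<and>
              fed_samples M S D K b \<xi> \<longrightarrow>
              fedavg_error M g G (fedavg_stepsize K T b) I b K x1 \<xi> T \<le> ennreal \<epsilon>)"
        using params by blast
    qed
  qed simp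
qed

end
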